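(* Let $X$ be a $d$-dimensional Itô-process with constant, deterministic and non-degenerate diffusion coefficient. Assume that $X$ has bounded drift while $X$ is in some open set $U\subseteq\mathbb{R}^d$. Let $t>0$. Then the function $$\rho_t(x) := \limsup_{\epsilon\to 0}\frac{P(\|X(t)-x\|<\epsilon)}{\operatorname{vol}(B_{\epsilon,\infty}(0))},\qquad x\in U,$$ is locally bounded on $U$. Moreover, $\rho_t$ is a version of the density of $X(t)$ on $U$, i.e. $P(X(t)\in A)=\int_A\rho_t(x)\,dx$ for any Borel set $A\subseteq U$. In particular, if $X$ has locally bounded drift, then $X(t)$ has a locally bounded version of its density.
   Context: Let $(\Omega,\mathcal{A},(\mathcal{F}_t)_{t\ge 0},P)$ be a stochastic basis with right-continuous and complete filtration. A $d$-dimensional Itô-process is a process $X$ of the form $X(t)=x_0+\int_0^t\beta(s)\,ds+\int_0^t\sigma(s)\,dW(s)$, $t\ge 0$, where $x_0\in\mathbb{R}^d$, $W$ is an $n$-dimensional standard $(\mathcal{F}_t)$-Brownian motion, $\beta$ (the drift) is an $\mathbb{R}^d$-valued progressively measurable process with locally integrable paths, and $\sigma$ (the diffusion coefficient) is an $\mathbb{R}^{d\times n}$-valued progressively measurable process with locally square integrable paths. Here $\|x\|:=\max_j|x_j|$ is the uniform norm on $\mathbb{R}^d$, $B_{\epsilon,\infty}(y):=\prod_{j=1}^d(y_j-\epsilon,y_j+\epsilon)$, and $\operatorname{vol}$ is Lebesgue measure. $X$ has bounded drift while $X$ is in an open set $U\subseteq\mathbb{R}^d$ if there is a constant $C>0$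 such that, $P$-a.s., $\|\beta_t\|1_{\{X(t)\in U\}}\le C$ for any $t\ge 0$. $X$ has locally bounded drift if, for every bounded open set $U$, $X$ has bounded drift while $X$ is in $U$. $X$ has non-degenerate diffusion coefficient if $\sigma_t\sigma_t^\top$ is positive definite for any $t\ge 0$. *)

theory Defs
  imports "HOL-Probability.Probability"
begin

section \<open>Stochastic bases\<close>

text \<open>Time is \<open>[0, \<infinity>)\<close>; processes and filtrations are indexed by all reals, but only
  their values at nonnegative times are ever constrained or used.
  The completeness clause says that \<open>F 0\<close> contains every subset of a \<open>P\<close>-null event; in
  particular the probability space itself is then complete.\<close>

locale stochastic_basis = prob_space M for M :: "'a measure" +
  fixes F :: "real \<Rightarrow> 'a measure"
  assumes subalgebra_F: "0 \<le> t \<Longrightarrow> subalgebra M (F t)"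
    and F_mono: "0 \<le> s \<Longrightarrow> s \<le> t \<Longrightarrow> sets (F s) \<subseteq> sets (F t)"
    and F_right_continuous: "0 \<le> s \<Longrightarrow> sets (F s) = (\<Inter>t\<in>{s<..}. sets (F t))"
    and F_complete: "N \<in> null_sets M \<Longrightarrow> B \<subseteq> N \<Longrightarrow> B \<in> sets (F 0)"

definition adapted :: "(real \<Rightarrow> 'a measure) \<Rightarrow> (real \<Rightarrow> 'a \<Rightarrow> 'b::topological_space) \<Rightarrow> bool" where
  "adapted F Y \<longleftrightarrow> (\<forall>t\<ge>0. Y t \<in> borel_measurable (F t))"

definition progressively_measurable ::
  "(real \<Rightarrow> 'a measure) \<Rightarrow> (real \<Rightarrow> 'a \<Rightarrow> 'b::topological_space) \<Rightarrow> bool" where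
  "progressively_measurable F Y \<longleftrightarrow>
     (\<forall>T\<ge>0. (\<lambda>(s, \<omega>). Y s \<omega>) \<in> borel_measurable (restrict_space borel {0..T} \<Otimes>\<^sub>M F T))"

definition tendsto_in_probability ::
  "'a measure \<Rightarrow> (nat \<Rightarrow> 'a \<Rightarrow> 'b::metric_space) \<Rightarrow> ('a \<Rightarrow> 'b) \<Rightarrow> bool" where
  "tendsto_in_probability M Y Z \<longleftrightarrow>
     (\<forall>e>0. (\<lambda>k. measure M {\<omega> \<in> space M. dist (Y k \<omega>) (Z \<omega>) > e}) \<longlonglongrightarrow> 0)"

definition standard_brownian_motion ::
  "'a measure \<Rightarrow> (real \<Rightarrow> 'a measure) \<Rightarrow> (real \<Rightarrow> 'a \<Rightarrow> real^'n) \<Rightarrow> bool" where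
  "standard_brownian_motion M F W \<longleftrightarrow>
     adapted F W \<and>
     (AE \<omega> in M. W 0 \<omega> = 0) \<and>
     (AE \<omega> in M. continuous_on {0..} (\<lambda>t. W t \<omega>)) \<and>
     (\<forall>s t. 0 \<le> s \<and> s < t \<longrightarrow>
        prob_space.indep_set M (sets (F s))
          {(\<lambda>\<omega>. W t \<omega> - W s \<omega>) -` B \<inter> space M | B. B \<in> sets borel} \<and>
        distributed M lborel (\<lambda>\<omega>. W t \<omega> - W s \<omega>)
          (\<lambda>x. ennreal (\<Prod>i\<in>UNIV. normal_density 0 (sqrt (t - s)) (x $ i))))"

section \<open>The stochastic integral\<close>

text \<open>A simple integrand is \<open>\<Sum>i<N. \<xi> i * 1_(\<tau> i, \<tau> (i+1)]\<close> with \<open>0 \<le> \<tau> 0 \<le> \<dots> \<le> \<tau> N\<close> and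
  bounded \<open>F (\<tau> i)\<close>-measurable \<open>\<xi> i\<close>.\<close>

record ('a, 'b) simple_integrand =
  pieces :: nat
  gridpoint :: "nat \<Rightarrow> real"
  coefficient :: "nat \<Rightarrow> 'a \<Rightarrow> 'b"

definition valid_simple_integrand ::
  "'a measure \<Rightarrow> (real \<Rightarrow> 'a measure) \<Rightarrow> ('a, 'b::real_normed_vector) simple_integrand \<Rightarrow> bool" where
  "valid_simple_integrand M F H \<longleftrightarrow>
     0 \<le> gridpoint H 0 \<and>
     (\<forall>i<pieces H. gridpoint H i \<le> gridpoint H (Suc i) \<and>
        coefficient H i \<in> borel_measurable (F (gridpoint H i)) \<and>
        (\<exists>C. \<forall>\<omega>\<in>space M. norm (coefficient H i \<omega>) \<le> C))"

definition simple_value :: "('a, 'b::real_vector) simple_integrand \<Rightarrow> real \<Rightarrow> 'a \<Rightarrow> 'b" where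
  "simple_value H t \<omega> =
     (\<Sum>i<pieces H. indicator {gridpoint H i<..gridpoint H (Suc i)} t *\<^sub>R coefficient H i \<omega>)"

definition simple_integral ::
  "(real \<Rightarrow> 'a \<Rightarrow> real^'n) \<Rightarrow> ('a, real^'n^'d) simple_integrand \<Rightarrow> real \<Rightarrow> 'a \<Rightarrow> real^'d" where
  "simple_integral W H t \<omega> =
     (\<Sum>i<pieces H. coefficient H i \<omega> *v
        (W (min (gridpoint H (Suc i)) t) \<omega> - W (min (gridpoint H i) t) \<omega>))"

text \<open>The norm of type \<open>real^'n^'d\<close> is the Frobenius norm.\<close>

definition simple_approximation ::
  "'a measure \<Rightarrow> (real \<Rightarrow> 'a measure) \<Rightarrow> (nat \<Rightarrow> ('a, real^'n^'d) simple_integrand) \<Rightarrow>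
   (real \<Rightarrow> 'a \<Rightarrow> real^'n^'d) \<Rightarrow> bool" where
  "simple_approximation M F H \<sigma> \<longleftrightarrow>
     (\<forall>k. valid_simple_integrand M F (H k)) \<and>
     (\<forall>T\<ge>0. tendsto_in_probability M
        (\<lambda>k \<omega>. LINT s:{0..T}|lborel. (norm (simple_value (H k) s \<omega> - \<sigma> s \<omega>))\<^sup>2) (\<lambda>\<omega>. 0))"

text \<open>\<open>is_Ito_integral M F W \<sigma> I\<close>: the process \<open>I\<close> is (a version of) \<open>\<integral>\<^sub>0\<^sup>\<cdot> \<sigma> dW\<close>, i.e. the
  continuous adapted process which is the limit in probability of the integrals of simple
  integrands approximating \<open>\<sigma>\<close>. For a progressively measurable \<open>\<sigma>\<close> with locally square
  integrable paths an approximating sequence exists and the limit does not depend on it; both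
  standard facts are part of the well-definedness of the integral and are recorded here.\<close>

definition is_Ito_integral ::
  "'a measure \<Rightarrow> (real \<Rightarrow> 'a measure) \<Rightarrow> (real \<Rightarrow> 'a \<Rightarrow> real^'n) \<Rightarrow>
   (real \<Rightarrow> 'a \<Rightarrow> real^'n^'d) \<Rightarrow> (real \<Rightarrow> 'a \<Rightarrow> real^'d) \<Rightarrow> bool" where
  "is_Ito_integral M F W \<sigma> I \<longleftrightarrow>
     adapted F I \<and>
     (AE \<omega> in M. continuous_on {0..} (\<lambda>t. I t \<omega>)) \<and>
     (\<exists>H. simple_approximation M F H \<sigma>) \<and>
     (\<forall>H. simple_approximation M F H \<sigma> \<longrightarrow>
        (\<forall>t\<ge>0. tendsto_in_probability M (\<lambda>k. simple_integral W (H k) t) (I t)))"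

section \<open>Ito processes\<close>

definition Ito_process ::
  "'a measure \<Rightarrow> (real \<Rightarrow> 'a measure) \<Rightarrow> (real \<Rightarrow> 'a \<Rightarrow> real^'n) \<Rightarrow> real^'d \<Rightarrow>
   (real \<Rightarrow> 'a \<Rightarrow> real^'d) \<Rightarrow> (real \<Rightarrow> 'a \<Rightarrow> real^'n^'d) \<Rightarrow> (real \<Rightarrow> 'a \<Rightarrow> real^'d) \<Rightarrow> bool" where
  "Ito_process M F W x0 \<beta> \<sigma> X \<longleftrightarrow>
     standard_brownian_motion M F W \<and>
     progressively_measurable F \<beta> \<and>
     (AE \<omega> in M. \<forall>T\<ge>0. set_integrable lborel {0..T} (\<lambda>s. \<beta> s \<omega>)) \<and>
     progressively_measurable F \<sigma> \<and>
     (AE \<omega> in M. \<forall>T\<ge>0. set_integrable lborel {0..T} (\<lambda>s. (norm (\<sigma> s \<omega>))\<^sup>2)) \<and>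
     (\<exists>I. is_Ito_integral M F W \<sigma> I \<and>
        (AE \<omega> in M. \<forall>t\<ge>0. X t \<omega> = x0 + (LINT s:{0..t}|lborel. \<beta> s \<omega>) + I t \<omega>))"

definition positive_definite :: "real^'d^'d \<Rightarrow> bool" where
  "positive_definite A \<longleftrightarrow> transpose A = A \<and> (\<forall>x. x \<noteq> 0 \<longrightarrow> x \<bullet> (A *v x) > 0)"

definition constant_deterministic :: "'a measure \<Rightarrow> (real \<Rightarrow> 'a \<Rightarrow> 'b) \<Rightarrow> bool" where
  "constant_deterministic M \<sigma> \<longleftrightarrow> (\<exists>S. \<forall>t\<ge>0. \<forall>\<omega>\<in>space M. \<sigma> t \<omega> = S)"

definition nondegenerate :: "'a measure \<Rightarrow> (real \<Rightarrow> 'a \<Rightarrow> real^'n^'d) \<Rightarrow> bool" where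
  "nondegenerate M \<sigma> \<longleftrightarrow>
     (\<forall>t\<ge>0. \<forall>\<omega>\<in>space M. positive_definite (\<sigma> t \<omega> ** transpose (\<sigma> t \<omega>)))"

text \<open>\<open>infnorm x\<close> is the uniform norm \<open>max\<^sub>j \<bar>x\<^sub>j\<bar>\<close>; see \<open>infnorm_cart\<close>.\<close>

definition bounded_drift_in ::
  "'a measure \<Rightarrow> (real \<Rightarrow> 'a \<Rightarrow> real^'d) \<Rightarrow> (real \<Rightarrow> 'a \<Rightarrow> real^'d) \<Rightarrow> (real^'d) set \<Rightarrow> bool" where
  "bounded_drift_in M \<beta> X U \<longleftrightarrow>
     (\<exists>C>0. AE \<omega> in M. \<forall>t\<ge>0. infnorm (\<beta> t \<omega>) * indicator U (X t \<omega>) \<le> C)"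

definition locally_bounded_drift ::
  "'a measure \<Rightarrow> (real \<Rightarrow> 'a \<Rightarrow> real^'d) \<Rightarrow> (real \<Rightarrow> 'a \<Rightarrow> real^'d) \<Rightarrow> bool" where
  "locally_bounded_drift M \<beta> X \<longleftrightarrow> (\<forall>U. open U \<and> bounded U \<longrightarrow> bounded_drift_in M \<beta> X U)"

section \<open>Densities\<close>

definition sup_ball :: "real \<Rightarrow> real^'d \<Rightarrow> (real^'d) set" where
  "sup_ball e y = {x. \<forall>j. x $ j \<in> {y $ j - e <..< y $ j + e}}"

definition limsup_density :: "'a measure \<Rightarrow> ('a \<Rightarrow> real^'d) \<Rightarrow> real^'d \<Rightarrow> ennreal" where
  "limsup_density M Y x =
     Limsup (at_right 0) (\<lambda>e. ennreal (measure M {\<omega> \<in> space M. infnorm (Y \<omega> - x) < e}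
                                       / measure lborel (sup_ball e (0 :: real^'d))))"

definition locally_bounded_on :: "(real^'d) set \<Rightarrow> (real^'d \<Rightarrow> ennreal) \<Rightarrow> bool" where
  "locally_bounded_on U f \<longleftrightarrow>
     (\<forall>x\<in>U. \<exists>V C. open V \<and> x \<in> V \<and> (\<forall>y\<in>V \<inter> U. f y \<le> ennreal C))"

definition density_version_on ::
  "'a measure \<Rightarrow> ('a \<Rightarrow> real^'d) \<Rightarrow> (real^'d) set \<Rightarrow> (real^'d \<Rightarrow> ennreal) \<Rightarrow> bool" where
  "density_version_on M Y U f \<longleftrightarrow>
     f \<in> borel_measurable (restrict_space borel U) \<and>
     (\<forall>A\<in>sets borel. A \<subseteq> U \<longrightarrow>
        emeasure M {\<omega> \<in> space M. Y \<omega> \<in> A} = (\<integral>\<^sup>+x\<in>A. f x \<partial>lborel))"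

end

theory Submission
  imports Defs
begin

text \<open>
  Since the diffusion coefficient is a constant matrix \<open>S\<close>, the process is
  \<open>X t = x0 + \<integral>\<^sub>0\<^sup>t \<beta> ds + S W(t)\<close>, and nondegeneracy gives \<open>S\<close> a right inverse \<open>R\<close>. The heart of
  the matter is that every \<open>x\<close> in \<open>U\<close> has a neighbourhood \<open>ball x r\<close> on which the law of \<open>X t\<close> is
  dominated by a multiple of Lebesgue measure. The proof follows the Gaussian smoothings
    \<open>g a z = P(z + S G \<in> A)\<close>, where \<open>G\<close> is a centred Gaussian vector of covariance \<open>a\<close> times the identity,
  of a set \<open>A \<subseteq> ball x r\<close> through dyadic scales \<open>a, 2a, 4a, \<dots>\<close>.

  Three properties of \<open>g\<close> are used. It is a semigroup: averaging \<open>g b\<close> over an independent noise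
  \<open>S G\<close> of variance \<open>h\<close> gives \<open>g (b + h)\<close>. A shift by \<open>S v\<close> costs, at the price of a slightly larger
  variance \<open>b > a\<close>, only the factor \<open>(b/a)\<^bsup>n/2\<^esup> exp (\<bar>v\<bar>\<^sup>2 / (2 (b - a)))\<close>. And \<open>g a z\<close> is at most
  a constant times \<open>vol A / a\<^bsup>d/2\<^esup>\<close>, because by the shift property \<open>g a\<close> is bounded by its average over a
  ball of radius \<open>\<surd>a\<close>.

  Condition at time \<open>s - h\<close> with \<open>h\<close> slightly below \<open>a\<close>. If the drift over \<open>[s - h, s]\<close> is at most
  \<open>C h\<close>, it is absorbed by the shift property with \<open>b = a + a\<surd>a\<close>, at the cost of a factor
  \<open>exp (c\<surd>a)\<close>; the Brownian increment then raises the variance to \<open>2 a\<close>. The drift is only controlled while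
  the path stays near \<open>x\<close>, but a path that ends near \<open>x\<close> and leaves the neighbourhood during
  \<open>[s - h, s]\<close> has to come back within that time using bounded drift, so its Brownian part oscillates by
  a fixed amount. This has probability \<open>exp (-const/a)\<close>, which beats the factor \<open>a\<^bsup>-d/2\<^esup>\<close>. Hence
  (\<open>one_scale_step\<close>)
    \<open>E g a (X s) \<le> exp (c\<surd>a) E g (2a) (X (s - h)) + c\<^sub>2 \<surd>a vol A\<close>.
  As \<open>\<surd>a\<close> is summable over dyadic scales, iterating up to a scale comparable with \<open>t\<close> gives a bound
  \<open>E g a (X t) \<le> K vol A\<close> with \<open>K\<close> independent of \<open>a\<close> (\<open>dyadic_iteration\<close>), and letting \<open>a\<close> tend to \<open>0\<close>
  yields \<open>P(X t \<in> A) \<le> K vol A\<close> for open \<open>A\<close> (\<open>law_le_volume\<close>).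

  What remains is real analysis. Local domination bounds the upper cube density locally and makes
  the law absolutely continuous on \<open>U\<close>; the Radon--Nikodym density agrees almost everywhere with the upper
  cube density by Lebesgue's differentiation theorem for cubes (\<open>cube_density_eq_density_AE\<close>), which is
  deduced from Vitali's covering lemma.
\<close>

section \<open>Gaussian smoothing of the indicator of a set\<close>

text \<open>The parameter is the variance of each coordinate, not the standard deviation: variances add
  under convolution.\<close>
definition gauss :: "real \<Rightarrow> real^'n \<Rightarrow> real" where
  "gauss a x = (\<Prod>i\<in>UNIV. normal_density 0 (sqrt a) (x $ i))"

lemma gauss_nonneg [simp]: "0 \<le> gauss a x"
  by (simp add: gauss_def prod_nonneg)

lemma borel_measurable_gauss [measurable]: "gauss a \<in> borel_measurable borel"
  unfolding gauss_def[abs_def] by measurable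

lemma gauss_eq_exp:
  fixes x :: "real^'n"
  assumes "0 < a"
  shows "gauss a x = (1 / sqrt (2 * pi * a)) ^ CARD('n) * exp (- (norm x)\<^sup>2 / (2 * a))"
proof -
  have "(norm x)\<^sup>2 = (\<Sum>i\<in>UNIV. (x $ i)\<^sup>2)"
    by (simp add: norm_vec_def L2_set_def sum_nonneg)
  moreover have "normal_density 0 (sqrt a) (x $ i) = 1 / sqrt (2 * pi * a) * exp (- (x $ i)\<^sup>2 / (2 * a))" for i
    using assms by (simp add: normal_density_def)
  ultimately show ?thesis
    by (simp only: gauss_def prod.distrib prod_constant exp_sum[symmetric] finite
      sum_negf sum_divide_distrib[symmetric])
qed

lemma gauss_normalization_rescale:
  assumes "0 < a" "0 < b"
  shows "(1 / sqrt (2 * pi * a)) ^ n = sqrt (b / a) ^ n * (1 / sqrt (2 * pi * b)) ^ n"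
proof -
  have "1 / sqrt (2 * pi * a) = sqrt (b / a) * (1 / sqrt (2 * pi * b))"
    using assms by (simp add: real_sqrt_mult real_sqrt_divide)
  then show ?thesis by (metis power_mult_distrib)
qed

lemma gauss_rescale:
  fixes x :: "real^'n"
  assumes "0 < a" "0 < b"
  shows "gauss a x = sqrt (b / a) ^ CARD('n) * exp ((norm x)\<^sup>2 / (2 * b) - (norm x)\<^sup>2 / (2 * a)) * gauss b x"
proof -
  have "exp (- (norm x)\<^sup>2 / (2 * a)) =
      exp ((norm x)\<^sup>2 / (2 * b) - (norm x)\<^sup>2 / (2 * a)) * exp (- (norm x)\<^sup>2 / (2 * b))"
    by (simp flip: exp_add)
  then show ?thesis
    using assms gauss_normalization_rescale[OF assms, of "CARD('n)"] by (simp only: gauss_eq_exp mult_ac)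
qed

text \<open>The weighted form of the triangle inequality behind the shift property: \<open>p\<^sup>2/a + q\<^sup>2/c\<close> exceeds
  \<open>(p + q)\<^sup>2/(a + c)\<close> by a perfect square.\<close>
lemma norm_add_sq_weighted:
  fixes y v :: "'a::real_normed_vector"
  assumes "0 < a" "a < b"
  shows "(norm (y + v))\<^sup>2 / b \<le> (norm y)\<^sup>2 / a + (norm v)\<^sup>2 / (b - a)"
proof -
  define p q c where "p = norm y" and "q = norm v" and "c = b - a"
  have c: "0 < c" "b = a + c" using assms by (auto simp: c_def)
  have "(norm (y + v))\<^sup>2 \<le> (p + q)\<^sup>2"
    unfolding p_def q_def by (intro power_mono norm_triangle_ineq) auto
  also have "(p + q)\<^sup>2 \<le> (p\<^sup>2 / a + q\<^sup>2 / c) * (a + c)"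
  proof -
    have "(p\<^sup>2 / a + q\<^sup>2 / c) * (a + c) - (p + q)\<^sup>2 = (p * c - q * a)\<^sup>2 / (a * c)"
      using assms(1) c(1) by (simp add: field_simps power2_eq_square)
    also have "\<dots> \<ge> 0" using assms(1) c(1) by simp
    finally show ?thesis by simp
  qed
  finally show ?thesis
    using assms c unfolding p_def q_def by (simp add: pos_divide_le_eq)
qed

text \<open>Shifting a Gaussian density is paid for by enlarging its variance. In contrast to the exact
  Cameron--Martin factor, the factor here does not depend on \<open>x\<close>, so it survives integration against an
  unknown law and allows the shift \<open>v\<close> to be random and dependent on everything else.\<close>
lemma gauss_shift_le:
  fixes x v :: "real^'n"
  assumes "0 < a" "a < b"
  shows "gauss a (x - v) \<le> sqrt (b / a) ^ CARD('n) * exp ((norm v)\<^sup>2 / (2 * (b - a))) * gauss b x"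
proof -
  have b: "0 < b" using assms by simp
  have *: "- (norm (x - v))\<^sup>2 / (2 * a) \<le> (norm v)\<^sup>2 / (2 * (b - a)) + - (norm x)\<^sup>2 / (2 * b)"
    using divide_right_mono[OF norm_add_sq_weighted[OF assms, of "x - v" v], of 2]
    by (simp add: add_divide_distrib mult.commute)
  have "gauss a (x - v) =
      sqrt (b / a) ^ CARD('n) * (1 / sqrt (2 * pi * b)) ^ CARD('n) * exp (- (norm (x - v))\<^sup>2 / (2 * a))"
    using assms(1) gauss_normalization_rescale[OF assms(1) b, of "CARD('n)"] by (simp only: gauss_eq_exp)
  also have "\<dots> \<le> sqrt (b / a) ^ CARD('n) * (1 / sqrt (2 * pi * b)) ^ CARD('n) *
      exp ((norm v)\<^sup>2 / (2 * (b - a)) + - (norm x)\<^sup>2 / (2 * b))"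
    using * assms b by (intro mult_left_mono) auto
  also have "\<dots> = sqrt (b / a) ^ CARD('n) * exp ((norm v)\<^sup>2 / (2 * (b - a))) * gauss b x"
    using b by (simp only: gauss_eq_exp exp_add mult_ac)
  finally show ?thesis .
qed

text \<open>Doubling the variance instead of integrating over the tail keeps the estimate pointwise: it
  bounds the mass of the tail and, at the same time, the part of a smoothed indicator that comes from far
  away.\<close>
lemma gauss_tail_le:
  fixes x :: "real^'n"
  assumes "0 < a" "0 \<le> \<rho>" "\<rho> \<le> norm x"
  shows "gauss a x \<le> sqrt 2 ^ CARD('n) * exp (- \<rho>\<^sup>2 / (4 * a)) * gauss (2 * a) x"
proof -
  have "\<rho>\<^sup>2 \<le> (norm x)\<^sup>2" using assms by (intro power_mono) auto
  then have "(norm x)\<^sup>2 / (2 * (2 * a)) - (norm x)\<^sup>2 / (2 * a) \<le> - \<rho>\<^sup>2 / (4 * a)"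
    using assms(1) by (simp add: field_simps)
  then have "exp ((norm x)\<^sup>2 / (2 * (2 * a)) - (norm x)\<^sup>2 / (2 * a)) \<le> exp (- \<rho>\<^sup>2 / (4 * a))"
    by simp
  then show ?thesis
    using gauss_rescale[of a "2 * a" x] assms(1) by (simp add: mult_left_mono mult_right_mono)
qed

text \<open>Fubini for a product of functions of the coordinates, with the coordinates indexed by \<open>'n\<close>
  rather than by the basis vectors of \<^typ>\<open>real^'n\<close>.\<close>
lemma nn_integral_prod_components:
  fixes f :: "'n::finite \<Rightarrow> real \<Rightarrow> ennreal"
  assumes [measurable]: "\<And>i. f i \<in> borel_measurable borel"
  shows "(\<integral>\<^sup>+x. (\<Prod>i\<in>UNIV. f i (x $ i)) \<partial>(lborel :: (real^'n) measure)) = (\<Prod>i\<in>UNIV. \<integral>\<^sup>+x. f i x \<partial>lborel)"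
proof -
  define ix where "ix = (\<lambda>b::real^'n. THE i. b = axis i 1)"
  have ix: "ix (axis i 1) = i" for i
    unfolding ix_def by (rule the_equality) (auto simp: axis_eq_axis)
  have inj: "inj (\<lambda>i::'n. axis i (1::real))" by (auto simp: inj_on_def axis_eq_axis)
  have B: "(Basis :: (real^'n) set) = range (\<lambda>i. axis i 1)" by (auto simp: Basis_vec_def)
  have "(\<integral>\<^sup>+x. (\<Prod>b\<in>Basis. f (ix b) (x \<bullet> b)) \<partial>(lborel :: (real^'n) measure)) = (\<Prod>b\<in>Basis. \<integral>\<^sup>+x. f (ix (b::real^'n)) x \<partial>lborel)"
    by (rule nn_integral_lborel_prod) auto
  then show ?thesis
    unfolding B by (simp add: prod.reindex[OF inj] ix inner_axis)
qed

lemma nn_integral_gauss: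
  assumes "0 < a"
  shows "(\<integral>\<^sup>+x. ennreal (gauss a (x::real^'n)) \<partial>lborel) = 1"
proof -
  have "(\<integral>\<^sup>+x. ennreal (normal_density 0 (sqrt a) x) \<partial>lborel) = 1"
    using prob_space.emeasure_space_1[OF prob_space_normal_density[of "sqrt a" 0]] assms
    by (simp add: emeasure_density)
  then show ?thesis
    unfolding gauss_def prod_ennreal[symmetric, OF normal_density_nonneg]
    by (subst nn_integral_prod_components) auto
qed

lemma gauss_convolution:
  assumes "0 < a" "0 < b"
  shows "(\<integral>\<^sup>+x. ennreal (gauss a x) * ennreal (gauss b (y - x)) \<partial>lborel) = ennreal (gauss (a + b) (y::real^'n))"
proof -
  have 1: "(\<integral>\<^sup>+x. ennreal (normal_density 0 (sqrt a) x) * ennreal (normal_density 0 (sqrt b) (u - x)) \<partial>lborel)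
      = ennreal (normal_density 0 (sqrt (a + b)) u)" for u
    using fun_cong[OF conv_normal_density_zero_mean[of "sqrt b" "sqrt a"], of u] assms
    by (simp add: ennreal_mult'' mult.commute add.commute)
  have "(\<integral>\<^sup>+x. ennreal (gauss a x) * ennreal (gauss b (y - x)) \<partial>lborel) =
      (\<integral>\<^sup>+x. (\<Prod>i\<in>UNIV. ennreal (normal_density 0 (sqrt a) (x $ i)) * ennreal (normal_density 0 (sqrt b) (y $ i - x $ i))) \<partial>lborel)"
    by (simp add: gauss_def prod_ennreal[symmetric] prod.distrib)
  also have "\<dots> = (\<Prod>i\<in>UNIV. \<integral>\<^sup>+x. ennreal (normal_density 0 (sqrt a) x) * ennreal (normal_density 0 (sqrt b) (y $ i - x)) \<partial>lborel)"
    by (rule nn_integral_prod_components) auto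
  also have "\<dots> = ennreal (gauss (a + b) y)"
    by (simp add: 1 gauss_def prod_ennreal)
  finally show ?thesis .
qed

lemma nn_integral_lborel_translate:
  fixes f :: "'b::euclidean_space \<Rightarrow> ennreal"
  assumes [measurable]: "f \<in> borel_measurable borel"
  shows "(\<integral>\<^sup>+x. f (c + x) \<partial>lborel) = (\<integral>\<^sup>+x. f x \<partial>lborel)"
proof -
  have "(\<integral>\<^sup>+x. f x \<partial>lborel) = (\<integral>\<^sup>+x. f x \<partial>distr lborel borel ((+) c))"
    by (simp add: lborel_distr_plus)
  also have "\<dots> = (\<integral>\<^sup>+x. f (c + x) \<partial>lborel)"
    by (subst nn_integral_distr) auto
  finally show ?thesis by simp
qed

lemma borel_measurable_matrix_vector_mult [measurable]:
  fixes S :: "real^'n^'d"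
  assumes [measurable]: "f \<in> borel_measurable M"
  shows "(\<lambda>x. S *v f x) \<in> borel_measurable M"
proof -
  have "(\<lambda>x. S *v x) \<in> borel_measurable borel"
    by (intro borel_measurable_continuous_onI continuous_intros linear_continuous_on
         matrix_vector_mul_bounded_linear)
  from measurable_compose[OF assms this] show ?thesis by simp
qed

definition smoothed :: "real^'n^'d \<Rightarrow> (real^'d) set \<Rightarrow> real \<Rightarrow> real^'d \<Rightarrow> ennreal" where
  "smoothed S A a z = (\<integral>\<^sup>+x. ennreal (gauss a x) * indicator A (z + S *v x) \<partial>lborel)"

lemma borel_measurable_smoothed [measurable]:
  assumes [measurable]: "A \<in> sets borel"
  shows "smoothed S A a \<in> borel_measurable borel"
proof -
  have "(\<lambda>(z, x). ennreal (gauss a x) * indicator A (z + S *v x)) \<in> borel_measurable (borel \<Otimes>\<^sub>M lborel)"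
    by measurable
  then show ?thesis
    unfolding smoothed_def[abs_def] by measurable
qed


text \<open>A displacement in the range of \<open>S\<close> can be moved into the Gaussian vector, where
  \<open>gauss_shift_le\<close> applies.\<close>
lemma smoothed_shift_le:
  fixes S :: "real^'n^'d"
  assumes [measurable]: "A \<in> sets borel" and ab: "0 < a" "a < b"
  shows "smoothed S A a (z + S *v v) \<le>
    ennreal (sqrt (b / a) ^ CARD('n) * exp ((norm v)\<^sup>2 / (2 * (b - a)))) * smoothed S A b z"
    (is "_ \<le> ennreal ?k0 * _")
proof -
  define k where "k = ?k0"
  have k: "0 \<le> k" using ab by (simp add: k_def)
  have "smoothed S A a (z + S *v v) =
      (\<integral>\<^sup>+x. (\<lambda>x. ennreal (gauss a (x - v)) * indicator A (z + S *v x)) (v + x) \<partial>lborel)"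
    unfolding smoothed_def
    by (intro nn_integral_cong) (simp add: matrix_vector_right_distrib add_ac)
  also have "\<dots> = (\<integral>\<^sup>+x. ennreal (gauss a (x - v)) * indicator A (z + S *v x) \<partial>lborel)"
    by (rule nn_integral_lborel_translate) measurable
  also have "\<dots> \<le> (\<integral>\<^sup>+x. ennreal k * (ennreal (gauss b x) * indicator A (z + S *v x)) \<partial>lborel)"
    using gauss_shift_le[OF ab, of _ v, folded k_def]
    by (intro nn_integral_mono) (auto simp: indicator_def ennreal_mult'[OF k, symmetric] intro!: ennreal_leI)
  also have "\<dots> = ennreal k * smoothed S A b z"
    unfolding smoothed_def by (rule nn_integral_cmult) measurable
  finally show ?thesis unfolding k_def .
qed

lemma smoothed_convolution:
  fixes S :: "real^'n^'d"
  assumes [measurable]: "A \<in> sets borel" and "0 < h" "0 < b"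
  shows "(\<integral>\<^sup>+x. ennreal (gauss h x) * smoothed S A b (z + S *v x) \<partial>lborel) = smoothed S A (b + h) z"
proof -
  have "(\<integral>\<^sup>+x. ennreal (gauss h x) * smoothed S A b (z + S *v x) \<partial>lborel) =
     (\<integral>\<^sup>+x. (\<integral>\<^sup>+y. ennreal (gauss h x) * ennreal (gauss b (y - x)) * indicator A (z + S *v y) \<partial>lborel) \<partial>lborel)"
  proof (rule nn_integral_cong)
    fix x :: "real^'n"
    have "smoothed S A b (z + S *v x) =
      (\<integral>\<^sup>+y. (\<lambda>y. ennreal (gauss b (y - x)) * indicator A (z + S *v y)) (x + y) \<partial>lborel)"
      unfolding smoothed_def
      by (intro nn_integral_cong) (simp add: matrix_vector_right_distrib add_ac)
    also have "\<dots> = (\<integral>\<^sup>+y. ennreal (gauss b (y - x)) * indicator A (z + S *v y) \<partial>lborel)"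
      by (rule nn_integral_lborel_translate) measurable
    finally show "ennreal (gauss h x) * smoothed S A b (z + S *v x) =
      (\<integral>\<^sup>+y. ennreal (gauss h x) * ennreal (gauss b (y - x)) * indicator A (z + S *v y) \<partial>lborel)"
      by (simp add: nn_integral_cmult mult.assoc)
  qed
  also have "\<dots> = (\<integral>\<^sup>+y. (\<integral>\<^sup>+x. ennreal (gauss h x) * ennreal (gauss b (y - x)) * indicator A (z + S *v y) \<partial>lborel) \<partial>lborel)"
    by (rule lborel_pair.Fubini') measurable
  also have "\<dots> = smoothed S A (b + h) z"
    unfolding smoothed_def
    by (intro nn_integral_cong) (simp add: nn_integral_multc gauss_convolution assms add.commute)
  finally show ?thesis .
qed

lemma norm_matrix_vector_bound:
  fixes S :: "real^'n^'d"
  obtains B where "0 < B" "\<And>x. norm (S *v x) \<le> B * norm x"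
proof -
  obtain K where "0 < K" "\<And>x. norm (S *v x) \<le> norm x * K"
    using bounded_linear.pos_bounded[OF matrix_vector_mul_bounded_linear[of S]] by blast
  then show ?thesis by (intro that[of K]) (auto simp: mult.commute)
qed

text \<open>Every displacement \<open>y\<close> of \<open>\<real>\<^sup>d\<close> is \<open>S v\<close> with \<open>v = R y\<close>, and for \<open>\<bar>y\<bar> < \<surd>a\<close> the shift
  property with \<open>b = 2 a\<close> costs a constant factor. So the smoothing at \<open>z\<close> is at most a constant times its
  average at scale \<open>2 a\<close> over the ball of radius \<open>\<surd>a\<close> around \<open>z\<close>, and integrating over all of \<open>\<real>\<^sup>d\<close>
  instead of that ball gives exactly the volume of \<open>A\<close>.\<close>
lemma smoothed_le_volume:
  fixes S :: "real^'n^'d" and R :: "real^'d^'n"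
  assumes SR: "S ** R = mat 1"
  obtains c where "0 < c"
    "\<And>A a z. A \<in> sets borel \<Longrightarrow> 0 < a \<Longrightarrow>
       smoothed S A a z \<le> ennreal (c / sqrt a ^ CARD('d)) * emeasure lborel A"
proof -
  obtain B where B: "0 < B" "\<And>y. norm (R *v y) \<le> B * norm y"
    using norm_matrix_vector_bound by blast
  define F where "F = sqrt 2 ^ CARD('n) * exp (B\<^sup>2 / 2)"
  define u where "u = unit_ball_vol (real CARD('d))"
  have u: "0 < u" unfolding u_def by simp
  have F: "0 < F" unfolding F_def by simp
  have "smoothed S A a z \<le> ennreal (F / u / sqrt a ^ CARD('d)) * emeasure lborel A"
    if [measurable]: "A \<in> sets borel" and a: "0 < a" for A a z
  proof -
    have step: "smoothed S A a z \<le> ennreal F * smoothed S A (2 * a) (z + y)" if y: "norm y < sqrt a" for y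
    proof -
      have "S *v (R *v y) = y" by (simp add: matrix_vector_mul_assoc SR)
      then have "smoothed S A a z = smoothed S A a ((z + y) + S *v (- (R *v y)))"
        by (simp add: matrix_vector_mul_linear linear_neg)
      also have "\<dots> \<le> ennreal (sqrt (2 * a / a) ^ CARD('n) * exp ((norm (- (R *v y)))\<^sup>2 / (2 * (2 * a - a))))
          * smoothed S A (2 * a) (z + y)"
        using a by (intro smoothed_shift_le) auto
      also have "\<dots> \<le> ennreal F * smoothed S A (2 * a) (z + y)"
      proof (intro mult_right_mono ennreal_leI)
        have "(norm (R *v y))\<^sup>2 \<le> (B * norm y)\<^sup>2" by (intro power_mono B) auto
        also have "\<dots> \<le> (B * sqrt a)\<^sup>2" using y B(1) by (intro power_mono mult_left_mono) auto
        also have "\<dots> = B\<^sup>2 * a" using a by (simp add: power_mult_distrib)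
        finally have "(norm (R *v y))\<^sup>2 / (2 * a) \<le> B\<^sup>2 / 2"
          using a by (simp add: field_simps)
        then show "sqrt (2 * a / a) ^ CARD('n) * exp ((norm (- (R *v y)))\<^sup>2 / (2 * (2 * a - a))) \<le> F"
          unfolding F_def using a by simp
      qed auto
      finally show ?thesis .
    qed
    have "smoothed S A a z * ennreal (u * sqrt a ^ CARD('d)) = (\<integral>\<^sup>+y. smoothed S A a z * indicator (ball (0::real^'d) (sqrt a)) y \<partial>lborel)"
      using a by (simp add: nn_integral_cmult_indicator emeasure_ball u_def)
    also have "\<dots> \<le> (\<integral>\<^sup>+y. ennreal F * smoothed S A (2 * a) (z + y) \<partial>lborel)"
      using step by (intro nn_integral_mono) (auto simp: indicator_def)
    also have "\<dots> = ennreal F * (\<integral>\<^sup>+y. smoothed S A (2 * a) (z + y) \<partial>lborel)"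
      by (rule nn_integral_cmult) measurable
    also have "(\<integral>\<^sup>+y. smoothed S A (2 * a) (z + y) \<partial>lborel) =
        (\<integral>\<^sup>+x. (\<integral>\<^sup>+y. ennreal (gauss (2 * a) x) * indicator A (z + y + S *v x) \<partial>lborel) \<partial>lborel)"
      unfolding smoothed_def by (rule lborel_pair.Fubini') measurable
    also have "\<dots> = (\<integral>\<^sup>+x. ennreal (gauss (2 * a) x) * emeasure lborel A \<partial>(lborel :: (real^'n) measure))"
    proof (rule nn_integral_cong)
      fix x :: "real^'n"
      have "(\<integral>\<^sup>+y. indicator A (z + y + S *v x) \<partial>lborel) = (\<integral>\<^sup>+y. indicator A ((z + S *v x) + y) \<partial>lborel)"
        by (simp add: add_ac)
      also have "\<dots> = emeasure lborel A"
        by (subst nn_integral_lborel_translate) auto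
      finally show "(\<integral>\<^sup>+y. ennreal (gauss (2 * a) x) * indicator A (z + y + S *v x) \<partial>lborel) =
          ennreal (gauss (2 * a) x) * emeasure lborel A"
        by (simp add: nn_integral_cmult)
    qed
    also have "\<dots> = emeasure lborel A"
      using a by (simp add: nn_integral_multc nn_integral_gauss)
    finally have *: "smoothed S A a z * ennreal (u * sqrt a ^ CARD('d)) \<le> ennreal F * emeasure lborel A" .
    have p: "0 < u * sqrt a ^ CARD('d)" using u a by simp
    have "smoothed S A a z = smoothed S A a z * ennreal (u * sqrt a ^ CARD('d)) * ennreal (1 / (u * sqrt a ^ CARD('d)))"
      using u a by (simp add: mult.assoc ennreal_mult''[symmetric])
    also have "\<dots> \<le> ennreal F * emeasure lborel A * ennreal (1 / (u * sqrt a ^ CARD('d)))"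
      by (rule mult_right_mono[OF *]) simp
    also have "\<dots> = (ennreal F * ennreal (1 / (u * sqrt a ^ CARD('d)))) * emeasure lborel A"
      by (simp only: mult_ac)
    also have "ennreal F * ennreal (1 / (u * sqrt a ^ CARD('d))) = ennreal (F / u / sqrt a ^ CARD('d))"
      using u F a by (subst ennreal_mult[symmetric]) auto
    finally show ?thesis .
  qed
  then show ?thesis using u F by (intro that[of "F / u"]) auto
qed

text \<open>Far from \<open>A\<close> only the Gaussian tail contributes. The bound keeps a smoothed indicator on the
  right-hand side, so that \<open>smoothed_le_volume\<close> still provides the factor \<open>vol A\<close>.\<close>
lemma smoothed_far_le:
  fixes S :: "real^'n^'d"
  assumes [measurable]: "A \<in> sets borel" and "0 < a" "0 \<le> \<rho>"
    and far: "\<And>x. z + S *v x \<in> A \<Longrightarrow> \<rho> \<le> norm x"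
  shows "smoothed S A a z \<le> ennreal (sqrt 2 ^ CARD('n) * exp (- \<rho>\<^sup>2 / (4 * a))) * smoothed S A (2 * a) z"
    (is "_ \<le> ennreal ?k * _")
proof -
  have "smoothed S A a z \<le> (\<integral>\<^sup>+x. ennreal ?k * (ennreal (gauss (2 * a) x) * indicator A (z + S *v x)) \<partial>lborel)"
    unfolding smoothed_def
    using gauss_tail_le[OF assms(2,3)] far
    by (intro nn_integral_mono) (auto simp: indicator_def ennreal_mult[symmetric] intro!: ennreal_leI)
  also have "\<dots> = ennreal ?k * smoothed S A (2 * a) z"
    unfolding smoothed_def by (rule nn_integral_cmult) measurable
  finally show ?thesis .
qed

lemma gauss_tail_mass_le:
  assumes "0 < a" "0 \<le> \<rho>"
  shows "(\<integral>\<^sup>+x. ennreal (gauss a (x::real^'n)) * indicator {x. \<rho> \<le> norm x} x \<partial>lborel)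
     \<le> ennreal (sqrt 2 ^ CARD('n) * exp (- \<rho>\<^sup>2 / (4 * a)))" (is "_ \<le> ennreal ?k")
proof -
  have "(\<integral>\<^sup>+x. ennreal (gauss a (x::real^'n)) * indicator {x. \<rho> \<le> norm x} x \<partial>lborel)
     \<le> (\<integral>\<^sup>+x. ennreal ?k * ennreal (gauss (2 * a) (x::real^'n)) \<partial>lborel)"
    using gauss_tail_le[OF assms]
    by (intro nn_integral_mono) (auto simp: indicator_def ennreal_mult[symmetric] intro!: ennreal_leI)
  also have "\<dots> = ennreal ?k"
    using assms by (simp add: nn_integral_cmult nn_integral_gauss)
  finally show ?thesis .
qed

text \<open>As the variance tends to \<open>0\<close>, the smoothed indicator recovers the indicator on open sets.\<close>
lemma smoothed_liminf_ge_1_interior: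
  fixes S :: "real^'n^'d"
  assumes [measurable]: "A \<in> sets borel" and z: "z \<in> interior A"
  shows "1 \<le> liminf (\<lambda>k. smoothed S A (inverse (real (Suc k))) z)"
proof -
  obtain B where B: "0 < B" "\<And>x. norm (S *v x) \<le> B * norm x"
    using norm_matrix_vector_bound by blast
  obtain r where r: "0 < r" "ball z r \<subseteq> A" using z by (auto simp: mem_interior)
  define \<rho> where "\<rho> = r / B"
  have \<rho>: "0 < \<rho>" using r B by (simp add: \<rho>_def)
  have in_A: "z + S *v x \<in> A" if "norm x < \<rho>" for x
  proof -
    have "norm (S *v x) < r"
      using B(2)[of x] that B(1) by (simp add: \<rho>_def field_simps)
    then have "z + S *v x \<in> ball z r" by (simp add: dist_norm)
    then show ?thesis using r by blast
  qed
  define \<epsilon> where "\<epsilon> = (\<lambda>a::real. ennreal (sqrt 2 ^ CARD('n) * exp (- \<rho>\<^sup>2 / (4 * a))))"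
  have lower: "1 - \<epsilon> a \<le> smoothed S A a z" if a: "0 < a" for a
  proof -
    have "1 = (\<integral>\<^sup>+x. ennreal (gauss a (x::real^'n)) \<partial>lborel)" by (simp add: nn_integral_gauss a)
    also have "\<dots> \<le> (\<integral>\<^sup>+x. ennreal (gauss a x) * indicator A (z + S *v x) +
        ennreal (gauss a x) * indicator {x. \<rho> \<le> norm x} x \<partial>lborel)"
      using in_A by (intro nn_integral_mono) (auto simp: indicator_def not_le)
    also have "\<dots> = smoothed S A a z + (\<integral>\<^sup>+x. ennreal (gauss a (x::real^'n)) * indicator {x. \<rho> \<le> norm x} x \<partial>lborel)"
      unfolding smoothed_def by (rule nn_integral_add) measurable
    also have "\<dots> \<le> smoothed S A a z + \<epsilon> a"
      unfolding \<epsilon>_def using a \<rho> by (intro add_left_mono gauss_tail_mass_le) auto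
    finally show ?thesis by (simp add: ennreal_minus_le_iff add.commute)
  qed
  have "(\<lambda>k. sqrt 2 ^ CARD('n) * exp (- \<rho>\<^sup>2 / 4 * real (Suc k))) \<longlonglongrightarrow> sqrt 2 ^ CARD('n) * 0"
  proof (intro tendsto_mult tendsto_const)
    have "filterlim (\<lambda>k. - \<rho>\<^sup>2 / 4 * real (Suc k)) at_bot sequentially"
      using \<rho> by (intro filterlim_tendsto_neg_mult_at_bot[OF tendsto_const]
        filterlim_compose[OF filterlim_real_sequentially filterlim_Suc]) auto
    then show "(\<lambda>k. exp (- \<rho>\<^sup>2 / 4 * real (Suc k))) \<longlonglongrightarrow> 0"
      by (rule filterlim_compose[OF exp_at_bot])
  qed
  moreover have "- \<rho>\<^sup>2 / 4 * real (Suc k) = - \<rho>\<^sup>2 / (4 * inverse (real (Suc k)))" for k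
    by (simp add: field_simps)
  ultimately have "(\<lambda>k. \<epsilon> (inverse (real (Suc k)))) \<longlonglongrightarrow> ennreal 0"
    unfolding \<epsilon>_def by (intro tendsto_ennrealI) (simp only: mult_zero_right)
  then have "(\<lambda>k. 1 - \<epsilon> (inverse (real (Suc k)))) \<longlonglongrightarrow> 1 - ennreal 0"
    by (intro tendsto_diff_ennreal tendsto_const) auto
  then have "liminf (\<lambda>k. 1 - \<epsilon> (inverse (real (Suc k)))) = 1"
    by (intro lim_imp_Liminf) auto
  moreover have "liminf (\<lambda>k. 1 - \<epsilon> (inverse (real (Suc k)))) \<le> liminf (\<lambda>k. smoothed S A (inverse (real (Suc k))) z)"
    using lower by (intro Liminf_mono always_eventually) auto
  ultimately show ?thesis by simp
qed

section \<open>Brownian increments and oscillations\<close>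

locale brownian_basis = stochastic_basis M F for M :: "'a measure" and F +
  fixes W :: "real \<Rightarrow> 'a \<Rightarrow> real^'n"
  assumes brownian: "standard_brownian_motion M F W"
begin

lemma space_F [simp]: "0 \<le> t \<Longrightarrow> space (F t) = space M"
  using subalgebra_F by (auto simp: subalgebra_def)

lemma measurable_F_mono:
  assumes "0 \<le> s" "s \<le> t" "f \<in> borel_measurable (F s)"
  shows "f \<in> borel_measurable (F t)"
  using assms F_mono[of s t] by (auto simp: measurable_def)

lemma measurable_F_M: "0 \<le> t \<Longrightarrow> f \<in> borel_measurable (F t) \<Longrightarrow> f \<in> borel_measurable M"
  by (rule measurable_from_subalg[OF subalgebra_F])

lemma W_measurable_F: "0 \<le> s \<Longrightarrow> s \<le> t \<Longrightarrow> W s \<in> borel_measurable (F t)"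
  using brownian measurable_F_mono[of s t "W s"]
  by (auto simp: standard_brownian_motion_def adapted_def)

lemma W_measurable [measurable]: "0 \<le> t \<Longrightarrow> W t \<in> borel_measurable M"
  using measurable_F_M[of t] W_measurable_F[of t t] by auto

lemma distributed_increment:
  "0 \<le> s \<Longrightarrow> s < t \<Longrightarrow> distributed M lborel (\<lambda>\<omega>. W t \<omega> - W s \<omega>) (\<lambda>x. ennreal (gauss (t - s) x))"
  using brownian by (auto simp: standard_brownian_motion_def gauss_def)

lemma indep_increment_event:
  assumes st: "0 \<le> s" "s < t" and A: "A \<in> sets (F s)" and B: "B \<in> sets borel"
  shows "prob (A \<inter> {\<omega> \<in> space M. W t \<omega> - W s \<omega> \<in> B}) = prob A * prob {\<omega> \<in> space M. W t \<omega> - W s \<omega> \<in> B}"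
proof -
  have "indep_set (sets (F s)) {(\<lambda>\<omega>. W t \<omega> - W s \<omega>) -` B \<inter> space M | B. B \<in> sets borel}"
    using brownian st by (auto simp: standard_brownian_motion_def)
  from indep_setD[OF this A, of "(\<lambda>\<omega>. W t \<omega> - W s \<omega>) -` B \<inter> space M"] B
  show ?thesis by (auto simp: vimage_def Int_def conj_commute)
qed

text \<open>Conditioning on the past: a variable known at time \<open>s\<close> and the increment after \<open>s\<close> have a
  product law, because the product formula holds on rectangles.\<close>
lemma nn_integral_indep_increment:
  assumes st: "0 \<le> s" "s < t" and Z: "Z \<in> borel_measurable (F s)"
    and f[measurable]: "f \<in> borel_measurable (borel \<Otimes>\<^sub>M borel)"
  shows "(\<integral>\<^sup>+\<omega>. f (Z \<omega> :: 'b::euclidean_space, W t \<omega> - W s \<omega>) \<partial>M) =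
    (\<integral>\<^sup>+\<omega>. (\<integral>\<^sup>+x. ennreal (gauss (t - s) x) * f (Z \<omega>, x) \<partial>lborel) \<partial>M)"
proof -
  let ?D = "\<lambda>\<omega>. W t \<omega> - W s \<omega>"
  have ZM[measurable]: "Z \<in> borel_measurable M" using measurable_F_M st Z by auto
  have WM[measurable]: "W t \<in> borel_measurable M" "W s \<in> borel_measurable M" using st by auto
  have D: "distr M borel ?D = density lborel (\<lambda>x. ennreal (gauss (t - s) x))"
    using distributed_distr_eq_density[OF distributed_increment[OF st]]
    by (simp add: distr_cong[of M M borel lborel ?D ?D])
  interpret Zs: prob_space "distr M borel Z" by (rule prob_space_distr) simp
  interpret Ds: prob_space "distr M borel ?D" by (rule prob_space_distr) simp
  have prod: "distr M borel Z \<Otimes>\<^sub>M distr M borel ?D = distr M (borel \<Otimes>\<^sub>M borel) (\<lambda>\<omega>. (Z \<omega>, ?D \<omega>))"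
  proof (rule pair_measure_eqI)
    fix A B assume "A \<in> sets (distr M borel Z)" "B \<in> sets (distr M borel ?D)"
    then have AB[measurable]: "A \<in> sets borel" "B \<in> sets borel" by auto
    have "Z -` A \<inter> space M \<in> sets (F s)"
      using measurable_sets[OF Z AB(1)] st by simp
    from indep_increment_event[OF st this AB(2)]
    have "prob (Z -` A \<inter> space M \<inter> {\<omega> \<in> space M. ?D \<omega> \<in> B}) = prob (Z -` A \<inter> space M) * prob (?D -` B \<inter> space M)"
      by (simp add: vimage_def Int_def conj_commute)
    moreover have "(\<lambda>\<omega>. (Z \<omega>, ?D \<omega>)) -` (A \<times> B) \<inter> space M = Z -` A \<inter> space M \<inter> {\<omega> \<in> space M. ?D \<omega> \<in> B}"
      by auto
    ultimately show "emeasure (distr M borel Z) A * emeasure (distr M borel ?D) B =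
        emeasure (distr M (borel \<Otimes>\<^sub>M borel) (\<lambda>\<omega>. (Z \<omega>, ?D \<omega>))) (A \<times> B)"
      by (simp add: emeasure_distr emeasure_eq_measure ennreal_mult'')
  qed (simp_all add: Zs.sigma_finite_measure_axioms Ds.sigma_finite_measure_axioms cong: sets_pair_measure_cong)
  have "(\<integral>\<^sup>+\<omega>. f (Z \<omega>, ?D \<omega>) \<partial>M) = (\<integral>\<^sup>+p. f p \<partial>distr M (borel \<Otimes>\<^sub>M borel) (\<lambda>\<omega>. (Z \<omega>, ?D \<omega>)))"
    by (subst nn_integral_distr) auto
  also have "\<dots> = (\<integral>\<^sup>+p. f p \<partial>(distr M borel Z \<Otimes>\<^sub>M distr M borel ?D))"
    unfolding prod ..
  also have "\<dots> = (\<integral>\<^sup>+z. (\<integral>\<^sup>+x. f (z, x) \<partial>distr M borel ?D) \<partial>distr M borel Z)"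
    by (rule Ds.nn_integral_fst[symmetric]) (simp add: prod)
  also have "\<dots> = (\<integral>\<^sup>+\<omega>. (\<integral>\<^sup>+x. f (Z \<omega>, x) \<partial>distr M borel ?D) \<partial>M)"
    by (rule nn_integral_distr) measurable
  also have "\<dots> = (\<integral>\<^sup>+\<omega>. (\<integral>\<^sup>+x. ennreal (gauss (t - s) x) * f (Z \<omega>, x) \<partial>lborel) \<partial>M)"
    unfolding D by (intro nn_integral_cong nn_integral_density) measurable
  finally show ?thesis .
qed

lemma increment_tail_le:
  assumes st: "0 \<le> s" "s < t" and \<rho>: "0 \<le> \<rho>"
  shows "prob {\<omega> \<in> space M. \<rho> \<le> norm (W t \<omega> - W s \<omega>)} \<le> sqrt 2 ^ CARD('n) * exp (- \<rho>\<^sup>2 / (4 * (t - s)))"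
proof -
  have WM[measurable]: "W t \<in> borel_measurable M" "W s \<in> borel_measurable M" using st by auto
  have "emeasure M {\<omega> \<in> space M. \<rho> \<le> norm (W t \<omega> - W s \<omega>)} =
      (\<integral>\<^sup>+\<omega>. indicator {x. \<rho> \<le> norm x} (W t \<omega> - W s \<omega>) \<partial>M)"
  proof -
    have "{\<omega> \<in> space M. \<rho> \<le> norm (W t \<omega> - W s \<omega>)} \<in> sets M" by measurable
    from nn_integral_indicator[OF this]
    have "emeasure M {\<omega> \<in> space M. \<rho> \<le> norm (W t \<omega> - W s \<omega>)} =
        (\<integral>\<^sup>+\<omega>. indicator {\<omega> \<in> space M. \<rho> \<le> norm (W t \<omega> - W s \<omega>)} \<omega> \<partial>M)" ..
    also have "\<dots> = (\<integral>\<^sup>+\<omega>. indicator {x. \<rho> \<le> norm x} (W t \<omega> - W s \<omega>) \<partial>M)"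
      by (intro nn_integral_cong) (simp add: indicator_def)
    finally show ?thesis .
  qed
  also have "\<dots> = (\<integral>\<^sup>+x. ennreal (gauss (t - s) (x::real^'n)) * indicator {x. \<rho> \<le> norm x} x \<partial>lborel)"
    using distributed_nn_integral[OF distributed_increment[OF st], of "indicator {x. \<rho> \<le> norm x}"] by simp
  also have "\<dots> \<le> ennreal (sqrt 2 ^ CARD('n) * exp (- \<rho>\<^sup>2 / (4 * (t - s))))"
    using st \<rho> by (intro gauss_tail_mass_le) auto
  finally show ?thesis
    by (simp add: emeasure_eq_measure)
qed

text \<open>Ottaviani's inequality. Decompose according to the first grid time at which the path is further
  than \<open>2 l\<close> from its start. From there, independently of the past, the remaining increment is smaller
  than \<open>l\<close> with probability at least one half, and then the path ends further than \<open>l\<close> from its start.\<close>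
lemma maximal_inequality_grid:
  fixes p :: "nat \<Rightarrow> real"
  assumes s: "0 \<le> s" and p: "mono p" "\<And>j. j \<le> N \<Longrightarrow> s \<le> p j \<and> p j \<le> t" and l: "0 < l"
    and half: "\<And>v. s \<le> v \<Longrightarrow> v < t \<Longrightarrow> prob {\<omega> \<in> space M. l \<le> norm (W t \<omega> - W v \<omega>)} \<le> 1/2"
  shows "prob {\<omega> \<in> space M. \<exists>j\<le>N. 2 * l < norm (W (p j) \<omega> - W s \<omega>)}
    \<le> 2 * prob {\<omega> \<in> space M. l \<le> norm (W t \<omega> - W s \<omega>)}"
proof -
  \<comment> \<open>\<open>A j\<close>: the first passage happens at the \<open>j\<close>-th grid time\<close>
  define A where "A = (\<lambda>j. {\<omega> \<in> space M. 2 * l < norm (W (p j) \<omega> - W s \<omega>) \<and> (\<forall>i<j. norm (W (p i) \<omega> - W s \<omega>) \<le> 2 * l)})"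
  define E where "E = {\<omega> \<in> space M. l \<le> norm (W t \<omega> - W s \<omega>)}"
  have p0: "0 \<le> p j" if "j \<le> N" for j using p(2)[OF that] s by auto
  have t0: "0 \<le> t" "s \<le> t" using p(2)[of 0] s by auto
  have WM[measurable]: "W t \<in> borel_measurable M" "W s \<in> borel_measurable M" using s t0 by auto
  have AF: "A j \<in> sets (F (p j))" if "j \<le> N" for j
  proof -
    have Wi: "W (p i) \<in> borel_measurable (F (p j))" if "i \<le> j" for i
    proof (rule W_measurable_F)
      show "p i \<le> p j" by (rule monoD[OF p(1) that])
      show "0 \<le> p i" using that \<open>j \<le> N\<close> by (intro p0) simp
    qed
    have Ws: "W s \<in> borel_measurable (F (p j))"
      by (rule W_measurable_F[OF s]) (use p(2)[OF that] in simp)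
    have norm: "(\<lambda>\<omega>. norm (W (p i) \<omega> - W s \<omega>)) \<in> borel_measurable (F (p j))" if "i \<le> j" for i
      by (rule measurable_compose[OF borel_measurable_diff[OF Wi[OF that] Ws] borel_measurable_norm])
    have "{\<omega> \<in> space (F (p j)). 2 * l < norm (W (p j) \<omega> - W s \<omega>)} \<in> sets (F (p j))"
      using norm[of j] by (simp add: borel_measurable_iff_greater)
    moreover have "{\<omega> \<in> space (F (p j)). norm (W (p i) \<omega> - W s \<omega>) \<le> 2 * l} \<in> sets (F (p j))" if "i < j" for i
      using norm[of i] that by (simp add: borel_measurable_iff_le)
    ultimately have "{\<omega> \<in> space (F (p j)). 2 * l < norm (W (p j) \<omega> - W s \<omega>) \<and>
        (\<forall>i\<in>{..<j}. norm (W (p i) \<omega> - W s \<omega>) \<le> 2 * l)} \<in> sets (F (p j))"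
      by (intro sets.sets_Collect_conj sets.sets_Collect_finite_All) auto
    then show ?thesis unfolding A_def space_F[OF p0[OF that]] Ball_def lessThan_iff .
  qed
  have AM[measurable]: "A j \<in> sets M" if "j \<le> N" for j
    using AF[OF that] subalgebra_F[OF p0[OF that]] by (auto simp: subalgebra_def)
  have E[measurable]: "E \<in> sets M" unfolding E_def by measurable
  have disj: "disjoint_family_on A {..N}"
    unfolding disjoint_family_on_def A_def by (auto simp: not_le) (meson linorder_neqE_nat not_le)
  have first: "{\<omega> \<in> space M. \<exists>j\<le>N. 2 * l < norm (W (p j) \<omega> - W s \<omega>)} = (\<Union>j\<in>{..N}. A j)"
  proof (intro equalityI subsetI)
    fix \<omega> assume w: "\<omega> \<in> {\<omega> \<in> space M. \<exists>j\<le>N. 2 * l < norm (W (p j) \<omega> - W s \<omega>)}"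
    then obtain j where j: "j \<le> N" "2 * l < norm (W (p j) \<omega> - W s \<omega>)"
      and least: "\<And>i. i < j \<Longrightarrow> \<not> (i \<le> N \<and> 2 * l < norm (W (p i) \<omega> - W s \<omega>))"
      using exists_least_iff[of "\<lambda>j. j \<le> N \<and> 2 * l < norm (W (p j) \<omega> - W s \<omega>)"] by auto
    have "norm (W (p i) \<omega> - W s \<omega>) \<le> 2 * l" if "i < j" for i
      using least[OF that] that j(1) by auto
    then show "\<omega> \<in> (\<Union>j\<in>{..N}. A j)"
      using w j unfolding A_def by auto
  qed (auto simp: A_def)
  have piece: "prob (A j) \<le> 2 * prob (A j \<inter> E)" if j: "j \<le> N" for j
  \<comment> \<open>at the end point there is no later increment, and the first passage itself lies in \<open>E\<close>\<close>
  proof (cases "p j = t")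
    case True
    have "A j \<subseteq> E" unfolding A_def E_def True[symmetric] using l by auto
    then show ?thesis by (simp add: Int_absorb2)
  next
    case False
    then have pj: "0 \<le> p j" "p j < t" "s \<le> p j" using p(2)[OF j] p0[OF j] by auto
    have [measurable]: "W (p j) \<in> borel_measurable M" using pj by auto
    let ?G = "{\<omega> \<in> space M. W t \<omega> - W (p j) \<omega> \<in> {x. norm x < l}}"
    have "prob ?G = 1 - prob {\<omega> \<in> space M. l \<le> norm (W t \<omega> - W (p j) \<omega>)}"
      by (subst prob_compl[symmetric]) (auto intro!: arg_cong[where f=prob])
    then have "1/2 \<le> prob ?G" using half[of "p j"] pj by auto
    then have "prob (A j) \<le> 2 * (prob (A j) * prob ?G)"
      using mult_left_mono[of "1/2" "prob ?G" "prob (A j)"] by simp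
    also have "prob (A j) * prob ?G = prob (A j \<inter> ?G)"
      by (rule indep_increment_event[OF pj(1,2) AF[OF j], symmetric]) simp
    also have "\<dots> \<le> prob (A j \<inter> E)"
    proof (rule finite_measure_mono)
      show "A j \<inter> ?G \<subseteq> A j \<inter> E"
      proof safe
        fix \<omega> assume "\<omega> \<in> A j" "\<omega> \<in> space M" and *: "norm (W t \<omega> - W (p j) \<omega>) < l"
        then have "2 * l < norm (W (p j) \<omega> - W s \<omega>)" by (simp add: A_def)
        with * norm_triangle_ineq4[of "W t \<omega> - W s \<omega>" "W t \<omega> - W (p j) \<omega>"]
        show "\<omega> \<in> E" using \<open>\<omega> \<in> space M\<close> by (simp add: E_def)
      qed
    qed (use AM[OF j] in measurable)
    finally show ?thesis by simp
  qed
  have "prob (\<Union>j\<in>{..N}. A j) = (\<Sum>j\<in>{..N}. prob (A j))"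
    using disj AM by (intro finite_measure_finite_Union) auto
  also have "\<dots> \<le> (\<Sum>j\<in>{..N}. 2 * prob (A j \<inter> E))"
    using piece by (intro sum_mono) auto
  also have "\<dots> = 2 * prob (\<Union>j\<in>{..N}. A j \<inter> E)"
    using disj AM by (subst finite_measure_finite_Union) (auto simp: disjoint_family_on_def sum_distrib_left)
  also have "\<dots> \<le> 2 * prob E"
    by (intro mult_left_mono finite_measure_mono) auto
  finally show ?thesis unfolding first E_def .
qed

text \<open>The maximal inequality over all times in \<open>[s, t]\<close>, by refining dyadic grids and continuity of
  the path. The exceptional event is given by dyadic times only and hence measurable, while the estimate
  off it needs a continuous path.\<close>
lemma oscillation_event:
  assumes s: "0 \<le> s" "s < t" and l: "0 < l"
    and small: "sqrt 2 ^ CARD('n) * exp (- l\<^sup>2 / (4 * (t - s))) \<le> 1/2"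
  obtains E where "E \<in> sets M" "prob E \<le> 2 * (sqrt 2 ^ CARD('n) * exp (- l\<^sup>2 / (4 * (t - s))))"
    "\<And>\<omega> v. \<omega> \<in> space M \<Longrightarrow> \<omega> \<notin> E \<Longrightarrow> continuous_on {0..} (\<lambda>t. W t \<omega>) \<Longrightarrow> s \<le> v \<Longrightarrow> v \<le> t \<Longrightarrow>
       norm (W v \<omega> - W s \<omega>) \<le> 2 * l"
proof -
  define p where "p = (\<lambda>N j. s + (t - s) * (real j / 2 ^ N))"
  define D where "D = (\<lambda>N. {\<omega> \<in> space M. \<exists>j\<le>2^N. 2 * l < norm (W (p N j) \<omega> - W s \<omega>)})"
  define c where "c = 2 * (sqrt 2 ^ CARD('n) * exp (- l\<^sup>2 / (4 * (t - s))))"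
  have p: "s \<le> p N j \<and> p N j \<le> t" if "j \<le> 2^N" for N j
  proof -
    have "real j \<le> 2 ^ N" using that by (metis of_nat_le_iff of_nat_numeral of_nat_power)
    then have "real j / 2 ^ N \<le> 1" by simp
    then have "(t - s) * (real j / 2 ^ N) \<le> (t - s) * 1" using s by (intro mult_left_mono) auto
    then show ?thesis using s by (simp add: p_def)
  qed
  have pmono: "mono (p N)" for N
    unfolding p_def using s by (intro monoI add_left_mono mult_left_mono divide_right_mono) auto
  have [measurable]: "W s \<in> borel_measurable M" using s by auto
  have [measurable]: "W (p N j) \<in> borel_measurable M" if "j \<le> 2^N" for N j
    using p[OF that] s by auto
  have DM: "D N \<in> sets M" for N
  proof -
    have "{\<omega> \<in> space M. \<exists>j\<in>{..2^N}. 2 * l < norm (W (p N j) \<omega> - W s \<omega>)} \<in> sets M"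
      by measurable
    then show ?thesis by (simp add: D_def Bex_def)
  qed
  have half: "prob {\<omega> \<in> space M. l \<le> norm (W t \<omega> - W v \<omega>)} \<le> 1/2" if v: "s \<le> v" "v < t" for v
  proof -
    have "prob {\<omega> \<in> space M. l \<le> norm (W t \<omega> - W v \<omega>)} \<le> sqrt 2 ^ CARD('n) * exp (- l\<^sup>2 / (4 * (t - v)))"
      using v s l by (intro increment_tail_le) auto
    also have "\<dots> \<le> sqrt 2 ^ CARD('n) * exp (- l\<^sup>2 / (4 * (t - s)))"
      using v s l by (intro mult_left_mono) (auto simp: field_simps)
    finally show ?thesis using small by simp
  qed
  have Dc: "prob (D N) \<le> c" for N
  proof -
    have "prob (D N) \<le> 2 * prob {\<omega> \<in> space M. l \<le> norm (W t \<omega> - W s \<omega>)}"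
      unfolding D_def using p half l s pmono by (intro maximal_inequality_grid) auto
    also have "\<dots> \<le> c" unfolding c_def using increment_tail_le[of s t l] s l by auto
    finally show ?thesis .
  qed
  have "incseq D"
  proof (rule incseq_SucI)
    fix N
    have "p (Suc N) (2 * j) = p N j" for j by (simp add: p_def)
    then have "\<exists>j'\<le>2 ^ Suc N. 2 * l < norm (W (p (Suc N) j') \<omega> - W s \<omega>)"
      if "j \<le> 2 ^ N" "2 * l < norm (W (p N j) \<omega> - W s \<omega>)" for j \<omega>
      using that by (intro exI[of _ "2 * j"]) simp
    then show "D N \<subseteq> D (Suc N)"
      unfolding D_def by blast
  qed
  then have "(\<lambda>N. prob (D N)) \<longlonglongrightarrow> prob (\<Union>N. D N)"
    using DM by (intro finite_Lim_measure_incseq) auto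
  then have bound: "prob (\<Union>N. D N) \<le> c"
    by (rule LIMSEQ_le_const2) (use Dc in auto)
  have "norm (W v \<omega> - W s \<omega>) \<le> 2 * l"
    if w: "\<omega> \<in> space M" "\<omega> \<notin> (\<Union>N. D N)" and cont: "continuous_on {0..} (\<lambda>t. W t \<omega>)"
      and v: "s \<le> v" "v \<le> t" for \<omega> v
  proof -
    define j where "j = (\<lambda>N. nat \<lfloor>(v - s) / (t - s) * 2 ^ N\<rfloor>)"
    have q: "0 \<le> (v - s) / (t - s)" "(v - s) / (t - s) \<le> 1" using v s by auto
    have jr: "real (j N) = of_int \<lfloor>(v - s) / (t - s) * 2 ^ N\<rfloor>" for N
    proof -
      have "0 \<le> (v - s) / (t - s) * 2 ^ N" using q(1) by (intro mult_nonneg_nonneg) auto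
      then show ?thesis unfolding j_def by (intro of_nat_nat) (simp only: zero_le_floor)
    qed
    have jle: "real (j N) \<le> (v - s) / (t - s) * 2 ^ N" and jgt: "(v - s) / (t - s) * 2 ^ N - 1 \<le> real (j N)" for N
      unfolding jr by linarith+
    have jN: "j N \<le> 2 ^ N" for N
    proof -
      have "real (j N) \<le> 1 * 2 ^ N"
        by (rule order_trans[OF jle mult_right_mono[OF q(2)]]) simp
      then show ?thesis by (metis mult_1 of_nat_le_iff of_nat_numeral of_nat_power)
    qed
    have "(\<lambda>N. real (j N) / 2 ^ N) \<longlonglongrightarrow> (v - s) / (t - s)"
    proof (rule tendsto_sandwich[OF always_eventually always_eventually])
      show "\<forall>N. (v - s) / (t - s) - (1/2) ^ N \<le> real (j N) / 2 ^ N"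
      proof
        fix N show "(v - s) / (t - s) - (1/2) ^ N \<le> real (j N) / 2 ^ N"
          using divide_right_mono[OF jgt[of N], of "2 ^ N"] by (simp add: diff_divide_distrib power_divide)
      qed
      show "\<forall>N. real (j N) / 2 ^ N \<le> (v - s) / (t - s)"
        using jle by (simp add: pos_divide_le_eq)
      have "(\<lambda>N. (v - s) / (t - s) - (1/2) ^ N) \<longlonglongrightarrow> (v - s) / (t - s) - 0"
        by (intro tendsto_intros LIMSEQ_power_zero) auto
      then show "(\<lambda>N. (v - s) / (t - s) - (1/2) ^ N) \<longlonglongrightarrow> (v - s) / (t - s)" by simp
    qed auto
    then have "(\<lambda>N. p N (j N)) \<longlonglongrightarrow> s + (t - s) * ((v - s) / (t - s))"
      unfolding p_def by (intro tendsto_add tendsto_mult tendsto_const)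
    then have "(\<lambda>N. p N (j N)) \<longlonglongrightarrow> v" using s by simp
    then have "(\<lambda>N. W (p N (j N)) \<omega>) \<longlonglongrightarrow> W v \<omega>"
      using s v p[OF jN] by (intro continuous_on_tendsto_compose[OF cont]) (auto intro: order_trans always_eventually)
    then have "(\<lambda>N. norm (W (p N (j N)) \<omega> - W s \<omega>)) \<longlonglongrightarrow> norm (W v \<omega> - W s \<omega>)"
      by (intro tendsto_intros)
    moreover have "norm (W (p N (j N)) \<omega> - W s \<omega>) \<le> 2 * l" for N
      using w jN[of N] by (auto simp: D_def not_less)
    ultimately show ?thesis by (intro LIMSEQ_le_const2) auto
  qed
  then show ?thesis using bound DM unfolding c_def by (intro that[of "\<Union>N. D N"]) auto
qed

end

section \<open>Paths with bounded drift near their endpoint\<close>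

lemma norm_set_integral_le:
  fixes \<beta> :: "real \<Rightarrow> 'b::{banach, second_countable_topology}"
  assumes int: "set_integrable lborel {u..s} \<beta>" and us: "u \<le> s" and C: "0 \<le> C"
    and bound: "\<And>v. u < v \<Longrightarrow> v \<le> s \<Longrightarrow> norm (\<beta> v) \<le> C"
  shows "norm (LINT v:{u..s}|lborel. \<beta> v) \<le> C * (s - u)"
proof -
  have "norm (LINT v:{u..s}|lborel. \<beta> v) \<le> (LINT v:{u..s}|lborel. norm (\<beta> v))"
    by (rule set_integral_norm_bound[OF int])
  also have "\<dots> \<le> (LINT v:{u..s}|lborel. C)"
  proof (rule set_integral_mono_AE)
    show "set_integrable lborel {u..s} (\<lambda>v. norm (\<beta> v))"
      using int by (rule set_integrable_norm)
    show "set_integrable lborel {u..s} (\<lambda>v. C)"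
      using us by (simp add: set_integrable_def)
    show "AE v \<in> {u..s} in lborel. norm (\<beta> v) \<le> C"
      using AE_lborel_singleton[of u] by eventually_elim (auto intro: bound)
  qed
  also have "\<dots> = C * (s - u)"
    using us by (simp add: set_lebesgue_integral_def)
  finally show ?thesis .
qed

lemma continuous_on_set_integral_upto:
  fixes \<beta> :: "real \<Rightarrow> 'b::euclidean_space"
  assumes int: "set_integrable lborel {u..s} \<beta>"
  shows "continuous_on {u..s} (\<lambda>v. LINT p:{u..v}|lborel. \<beta> p)"
proof -
  have "set_integrable lborel {u..v} \<beta>" if "v \<in> {u..s}" for v
    using int that by (intro set_integrable_subset[OF int]) auto
  then have eq: "(LINT p:{u..v}|lborel. \<beta> p) = integral {u..v} \<beta>" if "v \<in> {u..s}" for v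
    using that by (intro set_borel_integral_eq_integral) auto
  have "\<beta> integrable_on {u..s}" by (rule set_borel_integral_eq_integral(1)[OF int])
  then have "continuous_on {u..s} (\<lambda>v. integral {u..v} \<beta>)"
    by (rule indefinite_integral_continuous_1)
  then show ?thesis using eq by (subst continuous_on_cong[OF refl]) auto
qed

text \<open>This is the localization. The drift is controlled only inside \<open>ball x (3 r)\<close>, and only the end
  of the path is known to be close to \<open>x\<close>. If the path were outside at some time, consider the last such
  time \<open>w\<close>. After \<open>w\<close> the drift is bounded, so drift and noise together move the path by at most
  \<open>3 r / 4\<close>; but it would have to travel more than \<open>r\<close> to end in \<open>ball x (2 r)\<close>.\<close>
lemma displacement_bound_from_endpoint:
  fixes y m :: "real \<Rightarrow> 'b::euclidean_space"
  assumes us: "u \<le> s" and r: "0 < r" and C: "0 \<le> C"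
    and int: "set_integrable lborel {u..s} \<beta>"
    and y: "\<And>v. u \<le> v \<Longrightarrow> v \<le> s \<Longrightarrow> y v = y u + (LINT p:{u..v}|lborel. \<beta> p) + m v"
    and m_cont: "continuous_on {u..s} m" and m: "\<And>v. u \<le> v \<Longrightarrow> v \<le> s \<Longrightarrow> norm (m v) \<le> r / 4"
    and bound: "\<And>v. u \<le> v \<Longrightarrow> v \<le> s \<Longrightarrow> y v \<in> ball x (3 * r) \<Longrightarrow> norm (\<beta> v) \<le> C"
    and short: "C * (s - u) \<le> r / 4" and s: "y s \<in> ball x (2 * r)"
  shows "norm (LINT p:{u..s}|lborel. \<beta> p) \<le> C * (s - u)"
proof -
  have "continuous_on {u..s} (\<lambda>v. y u + (LINT p:{u..v}|lborel. \<beta> p) + m v)"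
    by (intro continuous_intros continuous_on_set_integral_upto int m_cont)
  then have y_cont: "continuous_on {u..s} y"
    by (rule continuous_on_eq) (simp add: y[symmetric])
  define T where "T = {v \<in> {u..s}. 3 * r \<le> dist x (y v)}"
  have "T = {}"
  proof (rule ccontr)
    assume "T \<noteq> {}"
    moreover have "compact T"
    proof -
      have "closed {z. 3 * r \<le> dist x z}"
        by (intro closed_Collect_le continuous_intros)
      then have "closed ({u..s} \<inter> y -` {z. 3 * r \<le> dist x z})"
        by (rule continuous_closed_preimage[OF y_cont closed_atLeastAtMost])
      then have "compact ({u..s} \<inter> ({u..s} \<inter> y -` {z. 3 * r \<le> dist x z}))"
        by (rule compact_Int_closed[OF compact_Icc])
      moreover have "{u..s} \<inter> ({u..s} \<inter> y -` {z. 3 * r \<le> dist x z}) = T"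
        by (auto simp: T_def)
      ultimately show ?thesis by simp
    qed
    ultimately obtain w where w: "w \<in> T" "\<And>v. v \<in> T \<Longrightarrow> v \<le> w"
      using compact_attains_sup[of T] by auto
    have uw: "u \<le> w" "w \<le> s" using w(1) by (auto simp: T_def)
    have int': "set_integrable lborel {u..w} \<beta>" "set_integrable lborel {w..s} \<beta>"
      using uw by (auto intro: set_integrable_subset[OF int])
    have "(LINT p:{u..s}|lborel. \<beta> p) = (LINT p:{u..w}|lborel. \<beta> p) + (LINT p:{w..s}|lborel. \<beta> p)"
    proof -
      have "(LINT p:{u..s}|lborel. \<beta> p) = (LINT p:{u..w} \<union> {w..s}|lborel. \<beta> p)"
        using uw by (simp add: ivl_disj_un)
      also have "\<dots> = (LINT p:{u..w}|lborel. \<beta> p) + (LINT p:{w..s}|lborel. \<beta> p)"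
        using AE_lborel_singleton[of w] by (intro set_integral_Un_AE int') auto
      finally show ?thesis .
    qed
    then have "y s - y w = (LINT p:{w..s}|lborel. \<beta> p) + (m s - m w)"
      using y[of s] y[of w] us uw by simp
    moreover have "norm (LINT p:{w..s}|lborel. \<beta> p) \<le> C * (s - w)"
    proof (rule norm_set_integral_le[OF int'(2) uw(2) C])
      fix v assume v: "w < v" "v \<le> s"
      then have "v \<notin> T" using w(2) by force
      then show "norm (\<beta> v) \<le> C" using v uw by (intro bound) (auto simp: T_def)
    qed
    moreover have "C * (s - w) \<le> C * (s - u)" using uw C by (intro mult_left_mono) auto
    moreover have "norm (m s - m w) \<le> r / 4 + r / 4"
      using m[of s] m[of w] uw us norm_triangle_ineq4[of "m s" "m w"] by linarith
    ultimately have "norm (y s - y w) \<le> r / 4 + (r / 4 + r / 4)"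
      using short norm_triangle_ineq[of "LINT p:{w..s}|lborel. \<beta> p" "m s - m w"] by simp
    moreover have "3 * r \<le> dist x (y w)" using w(1) by (simp add: T_def)
    moreover have "dist x (y w) \<le> dist x (y s) + norm (y s - y w)"
      by (metis dist_norm dist_triangle)
    ultimately show False using s r by simp
  qed
  then show ?thesis
    by (intro norm_set_integral_le[OF int us C] bound) (auto simp: T_def)
qed

section \<open>Doubling the smoothing scale\<close>

text \<open>Gaussian tail probabilities at scale \<open>a\<close> beat every power of \<open>a\<close>.\<close>
lemma exp_inverse_le_power:
  fixes \<kappa> :: real
  assumes \<kappa>: "0 < \<kappa>" and m: "0 < m" and a: "0 < a"
  shows "exp (- \<kappa> / a) \<le> (real m / \<kappa>) ^ m * a ^ m"
proof -
  have "\<kappa> / (real m * a) \<le> exp (\<kappa> / (real m * a))"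
    using exp_ge_add_one_self[of "\<kappa> / (real m * a)"] by linarith
  then have "(\<kappa> / (real m * a)) ^ m \<le> exp (\<kappa> / (real m * a)) ^ m"
    using assms by (intro power_mono) auto
  also have "\<dots> = exp (\<kappa> / a)" using m by (simp flip: exp_of_nat_mult)
  finally have "inverse (exp (\<kappa> / a)) \<le> inverse ((\<kappa> / (real m * a)) ^ m)"
    using assms by (intro le_imp_inverse_le) auto
  then show ?thesis
    using assms by (simp add: exp_minus power_divide power_mult_distrib field_simps)
qed

text \<open>The abstract iteration. Here \<open>\<Phi> a s\<close> stands for the expected smoothing at scale \<open>a\<close> and
  time \<open>s\<close>. The multiplicative losses \<open>exp (c \<surd>a)\<close> and the additive losses \<open>c\<^sub>2 \<surd>a\<close> are absorbed together
  by proving the stronger bound \<open>\<psi> a = L exp (- \<theta> \<surd>a)\<close>: from \<open>2 a\<close> to \<open>a\<close> it gains the factor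
  \<open>exp (\<theta> (\<surd>2 - 1) \<surd>a)\<close>, and \<open>\<theta>\<close> is chosen so that this is \<open>exp ((c + 1) \<surd>a)\<close>, which pays for the
  multiplicative loss and leaves \<open>exp \<surd>a\<close> for the additive one. The condition \<open>2 \<delta> - a \<le> s\<close> provides
  enough time for all steps, since the step at scale \<open>a\<close> takes time at most \<open>a\<close>. The final constant does not
  depend on \<open>a\<close>.\<close>
lemma dyadic_iteration:
  fixes \<Phi> :: "real \<Rightarrow> real \<Rightarrow> ennreal"
  assumes \<delta>: "0 < \<delta>" "\<delta> \<le> 1" and c: "0 \<le> c" "0 \<le> c\<^sub>0" "0 \<le> c\<^sub>2"
    and step: "\<And>a s. 0 < a \<Longrightarrow> a \<le> \<delta> \<Longrightarrow> a \<le> s \<Longrightarrow>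
      \<Phi> a s \<le> ennreal (exp (c * sqrt a)) * \<Phi> (2 * a) (s - a * (1 - sqrt a)) + ennreal (c\<^sub>2 * sqrt a) * V"
    and base: "\<And>a s. \<delta> / 2 < a \<Longrightarrow> a \<le> \<delta> \<Longrightarrow> a \<le> s \<Longrightarrow> \<Phi> a s \<le> ennreal c\<^sub>0 * V"
    and a: "0 < a" "a \<le> \<delta>" and s: "2 * \<delta> - a \<le> s"
  shows "\<Phi> a s \<le> ennreal (exp ((c + 1) / (sqrt 2 - 1)) * (c\<^sub>0 + 2 * c\<^sub>2)) * V"
proof -
  define \<theta> where "\<theta> = (c + 1) / (sqrt 2 - 1)"
  define L where "L = exp \<theta> * (c\<^sub>0 + 2 * c\<^sub>2)"
  define \<psi> where "\<psi> = (\<lambda>a. L * exp (- \<theta> * sqrt a))"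
  have sqrt2: "0 < sqrt 2 - 1" by simp
  have \<theta>: "0 \<le> \<theta>" "\<theta> * (sqrt 2 - 1) = c + 1" using c sqrt2 by (auto simp: \<theta>_def)
  have L: "0 \<le> L" using c by (simp add: L_def)
  have \<psi>_ge: "c\<^sub>0 + 2 * c\<^sub>2 \<le> \<psi> a" if "0 < a" "a \<le> \<delta>" for a
  proof -
    have "sqrt a \<le> 1" using that \<delta> by simp
    then have "\<theta> * sqrt a \<le> \<theta> * 1" using \<theta> by (intro mult_left_mono)
    then have "(c\<^sub>0 + 2 * c\<^sub>2) * 1 \<le> (c\<^sub>0 + 2 * c\<^sub>2) * exp (\<theta> - \<theta> * sqrt a)"
      using c by (intro mult_left_mono) auto
    then show ?thesis by (simp add: \<psi>_def L_def exp_diff exp_minus field_simps)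
  qed
  \<comment> \<open>\<open>\<psi>\<close> is a supersolution of the recursion\<close>
  have contraction: "exp (c * sqrt a) * \<psi> (2 * a) + c\<^sub>2 * sqrt a \<le> \<psi> a" if a: "0 < a" "a \<le> \<delta>" for a
  proof -
    define q where "q = sqrt a"
    have q: "0 < q" "q \<le> 1" using a \<delta> by (auto simp: q_def)
    have "c * q + - \<theta> * (sqrt 2 * q) = - \<theta> * q - q"
      using arg_cong[OF \<theta>(2), of "\<lambda>x. x * q"] by (simp add: algebra_simps)
    then have "exp (c * q + - \<theta> * (sqrt 2 * q)) = exp (- \<theta> * q + - q)" by (simp only: diff_conv_add_uminus)
    then have exps: "exp (c * q) * exp (- \<theta> * (sqrt 2 * q)) = exp (- \<theta> * q) * exp (- q)"
      by (simp only: exp_add)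
    have "exp (c * sqrt a) * \<psi> (2 * a) = L * (exp (c * q) * exp (- \<theta> * (sqrt 2 * q)))"
      unfolding \<psi>_def q_def[symmetric] real_sqrt_mult by (simp only: mult_ac)
    also have "\<dots> = \<psi> a * exp (- q)"
      unfolding exps by (simp add: \<psi>_def q_def)
    finally have "exp (c * sqrt a) * \<psi> (2 * a) = \<psi> a * exp (- q)" .
    moreover have "exp (- q) \<le> 1 - q / 2"
    proof -
      have "exp (- q) \<le> 1 / (1 + q)"
        using exp_ge_add_one_self[of q] q by (simp add: exp_minus inverse_eq_divide frac_le)
      also have "\<dots> \<le> 1 - q / 2"
        using q mult_left_mono[of q 1 q] by (simp add: field_simps)
      finally show ?thesis .
    qed
    then have "\<psi> a * exp (- q) \<le> \<psi> a * (1 - q / 2)"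
      using L by (intro mult_left_mono) (auto simp: \<psi>_def)
    moreover have "c\<^sub>2 * q \<le> \<psi> a * (q / 2)"
    proof -
      have "c\<^sub>2 * q = (2 * c\<^sub>2) * (q / 2)" by simp
      also have "\<dots> \<le> \<psi> a * (q / 2)"
        using \<psi>_ge[OF a] q c by (intro mult_right_mono) auto
      finally show ?thesis .
    qed
    moreover have "\<psi> a * (1 - q / 2) = \<psi> a - \<psi> a * (q / 2)" by (simp add: right_diff_distrib)
    ultimately show ?thesis unfolding q_def by linarith
  qed
  have main: "\<Phi> a s \<le> ennreal (\<psi> a) * V" if "\<delta> / 2 ^ Suc k < a" "a \<le> \<delta>" "2 * \<delta> - a \<le> s" for k a s
    using that
  proof (induction k arbitrary: a s)
    case 0
    then have "0 < a" "a \<le> s" using \<delta> by auto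
    then have "\<Phi> a s \<le> ennreal c\<^sub>0 * V" using 0 by (intro base) auto
    also have "\<dots> \<le> ennreal (\<psi> a) * V"
      using \<psi>_ge[of a] \<open>0 < a\<close> 0 c by (intro mult_right_mono ennreal_leI) auto
    finally show ?case .
  next
    case (Suc k)
    have "0 < \<delta> / 2 ^ Suc (Suc k)" using \<delta> by simp
    then have a: "0 < a" using Suc.prems by linarith
    show ?case
    proof (cases "\<delta> / 2 ^ Suc k < a")
      case True then show ?thesis using Suc by blast
    next
      case False
      then have "a \<le> \<delta> / 2 ^ Suc k" by simp
      also have "\<dots> \<le> \<delta> / 2"
        using \<delta> by (simp add: field_simps)
      finally have a2: "2 * a \<le> \<delta>" by simp
      have "sqrt a \<le> 1" using a Suc.prems \<delta> by simp
      then have "a * (1 - sqrt a) \<le> a * 1" using a by (intro mult_left_mono) auto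
      then have s2: "2 * \<delta> - 2 * a \<le> s - a * (1 - sqrt a)" using Suc.prems by linarith
      have "\<Phi> (2 * a) (s - a * (1 - sqrt a)) \<le> ennreal (\<psi> (2 * a)) * V"
        using Suc.prems a2 s2 by (intro Suc.IH) (auto simp: field_simps)
      then have "\<Phi> a s \<le> ennreal (exp (c * sqrt a)) * (ennreal (\<psi> (2 * a)) * V) + ennreal (c\<^sub>2 * sqrt a) * V"
        using step[of a s] a Suc.prems \<delta>
        by (intro order_trans[OF step add_right_mono[OF mult_left_mono]]) auto
      also have "\<dots> = ennreal (exp (c * sqrt a) * \<psi> (2 * a) + c\<^sub>2 * sqrt a) * V"
        using L c a by (simp add: ennreal_plus ennreal_mult' distrib_right mult.assoc \<psi>_def)
      also have "\<dots> \<le> ennreal (\<psi> a) * V"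
        using contraction[OF a] Suc.prems by (intro mult_right_mono ennreal_leI) auto
      finally show ?thesis .
    qed
  qed
  obtain k where "\<delta> / a < 2 ^ k" using real_arch_pow[of 2 "\<delta> / a"] by auto
  also have "(2::real) ^ k \<le> 2 ^ Suc k" by simp
  finally have "\<delta> / 2 ^ Suc k < a" using a by (simp add: field_simps)
  then have "\<Phi> a s \<le> ennreal (\<psi> a) * V" using main a s by blast
  also have "\<dots> \<le> ennreal L * V"
    using L \<theta> a by (intro mult_right_mono ennreal_leI) (auto simp: \<psi>_def mult_left_le)
  finally show ?thesis unfolding L_def \<theta>_def .
qed

text \<open>A Brownian motion with constant diffusion matrix and progressively measurable drift. The
  drift may depend on the whole past of the path and on further randomness.\<close>
locale drifted_brownian = brownian_basis M F W
  for M :: "'a measure" and F and W :: "real \<Rightarrow> 'a \<Rightarrow> real^'n" +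
  fixes S :: "real^'n^'d" and x0 :: "real^'d" and \<beta> :: "real \<Rightarrow> 'a \<Rightarrow> real^'d"
  assumes drift_progressive: "progressively_measurable F \<beta>"
    and drift_integrable: "AE \<omega> in M. \<forall>T\<ge>0. set_integrable lborel {0..T} (\<lambda>s. \<beta> s \<omega>)"
begin

definition drifted :: "real \<Rightarrow> 'a \<Rightarrow> real^'d" where
  "drifted t \<omega> = x0 + (LINT s:{0..t}|lborel. \<beta> s \<omega>) + S *v W t \<omega>"

text \<open>This is where progressive measurability enters: Fubini's theorem on \<open>[0, t]\<close> makes the drift
  accumulated up to \<open>t\<close> measurable with respect to \<open>F t\<close>, so that it is independent of later increments
  of \<open>W\<close>.\<close>
lemma drifted_measurable_F:
  assumes t: "0 \<le> t"
  shows "drifted t \<in> borel_measurable (F t)"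
proof -
  let ?L = "restrict_space lborel {0..t}"
  interpret L: finite_measure ?L
    using t by (intro finite_measureI) (simp add: emeasure_restrict_space space_restrict_space)
  have "(\<lambda>(s, \<omega>). \<beta> s \<omega>) \<in> borel_measurable (restrict_space borel {0..t} \<Otimes>\<^sub>M F t)"
    using drift_progressive t by (auto simp: progressively_measurable_def)
  also have "borel_measurable (restrict_space borel {0..t} \<Otimes>\<^sub>M F t) = borel_measurable (?L \<Otimes>\<^sub>M F t)"
    by (intro measurable_cong_sets sets_pair_measure_cong sets_restrict_space_cong) auto
  finally have "(\<lambda>(\<omega>, s). \<beta> s \<omega>) \<in> borel_measurable (F t \<Otimes>\<^sub>M ?L)"
    by (subst measurable_pair_swap_iff) (simp add: case_prod_beta)
  then have "(\<lambda>\<omega>. \<integral>s. \<beta> s \<omega> \<partial>?L) \<in> borel_measurable (F t)"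
    by (rule L.borel_measurable_lebesgue_integral)
  also have "(\<lambda>\<omega>. \<integral>s. \<beta> s \<omega> \<partial>?L) = (\<lambda>\<omega>. LINT s:{0..t}|lborel. \<beta> s \<omega>)"
    by (intro ext) (simp add: integral_restrict_space set_lebesgue_integral_def)
  finally have "(\<lambda>\<omega>. LINT s:{0..t}|lborel. \<beta> s \<omega>) \<in> borel_measurable (F t)" .
  moreover have "(\<lambda>\<omega>. S *v W t \<omega>) \<in> borel_measurable (F t)"
    using W_measurable_F[of t t] t by (intro borel_measurable_matrix_vector_mult) auto
  ultimately show ?thesis
    unfolding drifted_def[abs_def] by (intro borel_measurable_add borel_measurable_const)
qed

lemma drifted_measurable [measurable]: "0 \<le> t \<Longrightarrow> drifted t \<in> borel_measurable M"
  using measurable_F_M drifted_measurable_F by blast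

lemma drifted_increment:
  assumes "\<forall>T\<ge>0. set_integrable lborel {0..T} (\<lambda>s. \<beta> s \<omega>)" "0 \<le> u" "u \<le> v"
  shows "drifted v \<omega> = drifted u \<omega> + (LINT p:{u..v}|lborel. \<beta> p \<omega>) + S *v (W v \<omega> - W u \<omega>)"
proof -
  have int: "set_integrable lborel {0..u} (\<lambda>s. \<beta> s \<omega>)" "set_integrable lborel {u..v} (\<lambda>s. \<beta> s \<omega>)"
    using assms by (auto intro: set_integrable_subset[of lborel "{0..v}"])
  have "(LINT p:{0..v}|lborel. \<beta> p \<omega>) = (LINT p:{0..u} \<union> {u..v}|lborel. \<beta> p \<omega>)"
    using assms by (simp add: ivl_disj_un)
  also have "\<dots> = (LINT p:{0..u}|lborel. \<beta> p \<omega>) + (LINT p:{u..v}|lborel. \<beta> p \<omega>)"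
    using AE_lborel_singleton[of u] by (intro set_integral_Un_AE int) auto
  finally show ?thesis by (simp add: drifted_def matrix_vector_mult_diff_distrib)
qed

text \<open>One step of the argument, from scale \<open>a\<close> at time \<open>s\<close> to scale \<open>2 a\<close> at time \<open>u = s - h\<close>
  with \<open>h = a (1 - \<surd>a)\<close>. Absorbing a drift of size \<open>C h\<close> raises the variance from \<open>a\<close> to
  \<open>b = a (1 + \<surd>a)\<close>, and averaging over the Brownian increment raises it to \<open>b + h = 2 a\<close>. The choice
  \<open>b - a = a \<surd>a\<close> balances the two parts of the loss: both \<open>(b/a)\<^bsup>n/2\<^esup>\<close> and
  \<open>exp (const h\<^sup>2 / (b - a))\<close> are \<open>exp (O(\<surd>a))\<close>. The remaining term collects the paths that end
  far from \<open>A\<close> and those whose Brownian part oscillates too much.\<close>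
lemma one_scale_step:
  assumes SR: "S ** R = mat 1" and r: "0 < r" and C: "0 \<le> C"
    and drift: "AE \<omega> in M. \<forall>t\<ge>0. drifted t \<omega> \<in> ball x (3 * r) \<longrightarrow> norm (\<beta> t \<omega>) \<le> C"
  obtains \<delta> c c\<^sub>2 where "0 < \<delta>" "\<delta> \<le> 1" "0 \<le> c" "0 \<le> c\<^sub>2"
    "\<And>a s A. 0 < a \<Longrightarrow> a \<le> \<delta> \<Longrightarrow> a \<le> s \<Longrightarrow> A \<in> sets borel \<Longrightarrow> A \<subseteq> ball x r \<Longrightarrow>
      (\<integral>\<^sup>+\<omega>. smoothed S A a (drifted s \<omega>) \<partial>M) \<le>
        ennreal (exp (c * sqrt a)) * (\<integral>\<^sup>+\<omega>. smoothed S A (2 * a) (drifted (s - a * (1 - sqrt a)) \<omega>) \<partial>M)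
        + ennreal (c\<^sub>2 * sqrt a) * emeasure lborel A"
proof -
  obtain B where B: "0 < B" "\<And>v. norm (S *v v) \<le> B * norm v"
    using norm_matrix_vector_bound by blast
  obtain B' where B': "0 < B'" "\<And>y. norm (R *v y) \<le> B' * norm y"
    using norm_matrix_vector_bound by blast
  obtain cv where cv: "0 < cv" "\<And>A a z. A \<in> sets borel \<Longrightarrow> 0 < a \<Longrightarrow>
       smoothed S A a z \<le> ennreal (cv / sqrt a ^ CARD('d)) * emeasure lborel A"
    using smoothed_le_volume[OF SR] by blast
  \<comment> \<open>an oscillation of \<open>W\<close> by at most \<open>2 l\<close> moves \<open>S W\<close> by at most \<open>r / 4\<close>\<close>
  define l where "l = r / (8 * B)"
  have l: "0 < l" using r B by (simp add: l_def)
  define k where "k = sqrt 2 ^ CARD('n)"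
  have k: "1 \<le> k" by (simp add: k_def)
  \<comment> \<open>\<open>\<surd>a\<close> to the power \<open>m\<close> compensates the factor \<open>a\<^bsup>-d/2\<^esup>\<close> and leaves one \<open>\<surd>a\<close>\<close>
  define m where "m = Suc CARD('d)"
  define \<kappa> where "\<kappa> = l\<^sup>2 / 4"
  have \<kappa>: "0 < \<kappa>" using l by (simp add: \<kappa>_def)
  define c where "c = real CARD('n) / 2 + (B' * C)\<^sup>2 / 2"
  define c\<^sub>2 where "c\<^sub>2 = 3 * k * cv * (real m / \<kappa>) ^ m"
  \<comment> \<open>the second term keeps the drift over one step below \<open>r / 4\<close>, the third one makes the tail
    probability at most \<open>1/2\<close>, as the maximal inequality requires\<close>
  define \<delta> where "\<delta> = min (1/4) (min (r / (4 * (C + 1))) (\<kappa> / (2 * k)))"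
  have \<delta>: "0 < \<delta>" "\<delta> \<le> 1/4" "\<delta> \<le> r / (4 * (C + 1))" "\<delta> \<le> \<kappa> / (2 * k)"
  proof -
    show "0 < \<delta>" unfolding \<delta>_def using r C \<kappa> k by simp
    show "\<delta> \<le> 1/4" "\<delta> \<le> r / (4 * (C + 1))" "\<delta> \<le> \<kappa> / (2 * k)"
      unfolding \<delta>_def by linarith+
  qed
  have "(\<integral>\<^sup>+\<omega>. smoothed S A a (drifted s \<omega>) \<partial>M) \<le>
        ennreal (exp (c * sqrt a)) * (\<integral>\<^sup>+\<omega>. smoothed S A (2 * a) (drifted (s - a * (1 - sqrt a)) \<omega>) \<partial>M)
        + ennreal (c\<^sub>2 * sqrt a) * emeasure lborel A"
    if a: "0 < a" "a \<le> \<delta>" and as: "a \<le> s" and A[measurable]: "A \<in> sets borel" and Ar: "A \<subseteq> ball x r" for a s A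
  proof -
    define V where "V = emeasure lborel A"
    define h u b where "h = a * (1 - sqrt a)" and "u = s - h" and "b = a + a * sqrt a"
    have a1: "a < 1" and sa: "0 < sqrt a" "sqrt a < 1" using a \<delta> by auto
    have h: "0 < h" "h \<le> a" using a sa by (auto simp: h_def)
    have u: "0 \<le> u" "u < s" using h as by (auto simp: u_def)
    have b: "a < b" "b + h = 2 * a" using a by (auto simp: b_def h_def algebra_simps)
    define tl where "tl = k * exp (- l\<^sup>2 / (4 * a))"
    have tl0: "0 \<le> tl" using k by (simp add: tl_def)
    have tail_h: "k * exp (- l\<^sup>2 / (4 * (s - u))) \<le> tl"
      unfolding tl_def using h a k l
      by (intro mult_left_mono) (auto simp: u_def divide_le_cancel frac_le)
    have "tl \<le> k * (1 / \<kappa>) ^ 1 * a ^ 1"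
      unfolding tl_def mult.assoc using exp_inverse_le_power[OF \<kappa> _ a(1), of 1] k
      by (intro mult_left_mono) (simp_all add: \<kappa>_def)
    also have "\<dots> \<le> 1/2"
    proof -
      have "a \<le> \<kappa> / (2 * k)" using a \<delta> by simp
      then show ?thesis using k \<kappa> by (simp add: field_simps)
    qed
    finally have half: "k * exp (- l\<^sup>2 / (4 * (s - u))) \<le> 1/2" using tail_h by simp
    obtain E where E: "E \<in> sets M" "prob E \<le> 2 * (k * exp (- l\<^sup>2 / (4 * (s - u))))"
      "\<And>\<omega> v. \<omega> \<in> space M \<Longrightarrow> \<omega> \<notin> E \<Longrightarrow> continuous_on {0..} (\<lambda>t. W t \<omega>) \<Longrightarrow> u \<le> v \<Longrightarrow> v \<le> s \<Longrightarrow>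
         norm (W v \<omega> - W u \<omega>) \<le> 2 * l"
      using oscillation_event[OF u l half[unfolded k_def]] unfolding k_def by blast
    note E(1)[measurable]
    have [measurable]: "drifted u \<in> borel_measurable M" "drifted s \<in> borel_measurable M"
      "W u \<in> borel_measurable M" "W s \<in> borel_measurable M"
      using u by auto
    \<comment> \<open>\<open>q\<close> is the bound for the smoothing at scale \<open>a\<close> that holds everywhere; \<open>Z\<close> is the path with the
      drift switched off during \<open>[u, s]\<close>\<close>
    define q where "q = ennreal (cv / sqrt a ^ CARD('d)) * V"
    define Z where "Z = (\<lambda>\<omega>. drifted u \<omega> + S *v (W s \<omega> - W u \<omega>))"
    have [measurable]: "Z \<in> borel_measurable M" unfolding Z_def by measurable
    have cont: "AE \<omega> in M. continuous_on {0..} (\<lambda>t. W t \<omega>)"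
      using brownian by (auto simp: standard_brownian_motion_def)
    have pointwise: "AE \<omega> in M. smoothed S A a (drifted s \<omega>) \<le>
        ennreal (exp (c * sqrt a)) * smoothed S A b (Z \<omega>) + (ennreal tl * q + q * indicator E \<omega>)"
      using cont drift_integrable drift AE_space
    proof eventually_elim
      case (elim \<omega>)
      consider "\<omega> \<in> E" | "drifted s \<omega> \<notin> ball x (2 * r)" | "\<omega> \<notin> E" "drifted s \<omega> \<in> ball x (2 * r)" by blast
      then show ?case
      \<comment> \<open>large oscillation: use the bound \<open>q\<close>; end point far from \<open>A\<close>: Gaussian tail; otherwise the drift is
        controlled by \<open>displacement_bound_from_endpoint\<close> and absorbed by the shift property\<close>
      proof cases
        case 1
        have "smoothed S A a (drifted s \<omega>) \<le> q" unfolding q_def V_def using a by (intro cv) auto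
        then show ?thesis using 1 by (simp add: add_increasing)
      next
        case 2
        have "l \<le> norm v" if "drifted s \<omega> + S *v v \<in> A" for v
        proof -
          have "dist x (drifted s \<omega> + S *v v) < r" using that Ar by auto
          moreover have "dist x (drifted s \<omega>) \<le> dist x (drifted s \<omega> + S *v v) + norm (S *v v)"
            using dist_triangle[of x "drifted s \<omega>" "drifted s \<omega> + S *v v"] by (simp add: dist_norm)
          ultimately have "r < norm (S *v v)" using 2 by simp
          also have "\<dots> \<le> B * norm v" by (rule B)
          finally have "r / B \<le> norm v" using B(1) by (simp add: field_simps)
          moreover have "l \<le> r / B" using B(1) r by (simp add: l_def field_simps)
          ultimately show ?thesis by simp
        qed
        then have "smoothed S A a (drifted s \<omega>) \<le> ennreal tl * smoothed S A (2 * a) (drifted s \<omega>)"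
          unfolding tl_def k_def using a l by (intro smoothed_far_le) auto
        also have "smoothed S A (2 * a) (drifted s \<omega>) \<le> ennreal (cv / sqrt (2 * a) ^ CARD('d)) * V"
          unfolding V_def using a by (intro cv) auto
        also have "\<dots> \<le> q"
          unfolding q_def using a cv(1)
          by (intro mult_right_mono ennreal_leI divide_left_mono power_mono) auto
        finally show ?thesis
          by (simp add: add_increasing add_increasing2 mult_left_mono)
      next
        case 3
        define D where "D = (LINT p:{u..s}|lborel. \<beta> p \<omega>)"
        have "norm D \<le> C * (s - u)" unfolding D_def
        proof (rule displacement_bound_from_endpoint[where y="\<lambda>v. drifted v \<omega>" and x=x and r=r and m="\<lambda>v. S *v (W v \<omega> - W u \<omega>)"])
          show "set_integrable lborel {u..s} (\<lambda>p. \<beta> p \<omega>)"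
            using elim(2) u by (auto intro: set_integrable_subset[of lborel "{0..s}"])
          show "drifted v \<omega> = drifted u \<omega> + (LINT p:{u..v}|lborel. \<beta> p \<omega>) + S *v (W v \<omega> - W u \<omega>)" if "u \<le> v" "v \<le> s" for v
            using elim(2) u that by (intro drifted_increment) auto
          have "continuous_on {u..s} (\<lambda>v. W v \<omega>)"
            using elim(1) u by (rule_tac continuous_on_subset) auto
          then show "continuous_on {u..s} (\<lambda>v. S *v (W v \<omega> - W u \<omega>))"
            by (intro bounded_linear.continuous_on[OF matrix_vector_mul_bounded_linear] continuous_intros)
          show "norm (S *v (W v \<omega> - W u \<omega>)) \<le> r / 4" if "u \<le> v" "v \<le> s" for v
          proof -
            have "norm (S *v (W v \<omega> - W u \<omega>)) \<le> B * norm (W v \<omega> - W u \<omega>)" by (rule B)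
            also have "\<dots> \<le> B * (2 * l)"
              using B(1) E(3)[OF elim(4) 3(1) elim(1) that] by (intro mult_left_mono) auto
            also have "\<dots> = r / 4" using B(1) by (simp add: l_def)
            finally show ?thesis .
          qed
          show "norm (\<beta> v \<omega>) \<le> C" if "u \<le> v" "v \<le> s" "drifted v \<omega> \<in> ball x (3 * r)" for v
            using elim(3) u that by auto
          have "C * (s - u) \<le> (C + 1) * \<delta>"
            using h a C by (intro mult_mono) (auto simp: u_def)
          also have "\<dots> \<le> r / 4" using \<delta>(3) C by (simp add: field_simps)
          finally show "C * (s - u) \<le> r / 4" .
        qed (use u r C 3 in auto)
        also have "\<dots> \<le> C * a" using h C by (intro mult_left_mono) (auto simp: u_def)
        finally have D: "norm D \<le> C * a" .
        \<comment> \<open>the accumulated drift \<open>D\<close> depends on the increment of \<open>W\<close>; the shift property holds for every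
          vector and therefore for this random one\<close>
        have "drifted s \<omega> = Z \<omega> + S *v (R *v D)"
          using drifted_increment[OF elim(2) u(1), of s] u SR
          by (simp add: Z_def D_def matrix_vector_mul_assoc)
        then have "smoothed S A a (drifted s \<omega>) \<le>
            ennreal (sqrt (b / a) ^ CARD('n) * exp ((norm (R *v D))\<^sup>2 / (2 * (b - a)))) * smoothed S A b (Z \<omega>)"
          using smoothed_shift_le[OF A a(1) b(1), of S "Z \<omega>" "R *v D"] by simp
        also have "\<dots> \<le> ennreal (exp (c * sqrt a)) * smoothed S A b (Z \<omega>)"
        proof (intro mult_right_mono ennreal_leI)
          have "b / a = 1 + sqrt a" using a by (simp add: b_def field_simps)
          then have "sqrt (b / a) \<le> sqrt (exp (sqrt a))"
            using exp_ge_add_one_self[of "sqrt a"] by simp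
          also have "\<dots> = exp (sqrt a / 2)"
            by (rule real_sqrt_unique) (auto simp: power2_eq_square simp flip: exp_add)
          finally have "sqrt (b / a) ^ CARD('n) \<le> exp (sqrt a / 2) ^ CARD('n)"
            using a b by (intro power_mono) auto
          also have "\<dots> = exp (real CARD('n) / 2 * sqrt a)"
            by (simp flip: exp_of_nat_mult)
          finally have 1: "sqrt (b / a) ^ CARD('n) \<le> exp (real CARD('n) / 2 * sqrt a)" .
          have "norm (R *v D) \<le> B' * norm D" by (rule B')
          also have "\<dots> \<le> B' * (C * a)" using D B' by (intro mult_left_mono) auto
          finally have "(norm (R *v D))\<^sup>2 \<le> (B' * C * a)\<^sup>2" by (intro power_mono) (auto simp: mult.assoc)
          also have "\<dots> = (B' * C)\<^sup>2 * sqrt a * (a * sqrt a)"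
            using a by (simp add: power_mult_distrib power2_eq_square)
          finally have "(norm (R *v D))\<^sup>2 / (2 * (b - a)) \<le> (B' * C)\<^sup>2 / 2 * sqrt a"
            using a by (simp add: b_def field_simps)
          then have 2: "exp ((norm (R *v D))\<^sup>2 / (2 * (b - a))) \<le> exp ((B' * C)\<^sup>2 / 2 * sqrt a)" by simp
          have "exp (real CARD('n) / 2 * sqrt a) * exp ((B' * C)\<^sup>2 / 2 * sqrt a) = exp (c * sqrt a)"
            unfolding c_def distrib_right exp_add ..
          then show "sqrt (b / a) ^ CARD('n) * exp ((norm (R *v D))\<^sup>2 / (2 * (b - a))) \<le> exp (c * sqrt a)"
            using mult_mono[OF 1 2] by simp
        qed simp
        finally show ?thesis by (simp add: add_increasing2)
      qed
    qed
    have "(\<integral>\<^sup>+\<omega>. smoothed S A a (drifted s \<omega>) \<partial>M) \<le>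
        (\<integral>\<^sup>+\<omega>. ennreal (exp (c * sqrt a)) * smoothed S A b (Z \<omega>) + (ennreal tl * q + q * indicator E \<omega>) \<partial>M)"
      by (rule nn_integral_mono_AE[OF pointwise])
    also have "\<dots> = ennreal (exp (c * sqrt a)) * (\<integral>\<^sup>+\<omega>. smoothed S A b (Z \<omega>) \<partial>M) + (ennreal tl * q + q * emeasure M E)"
      by (simp add: nn_integral_add nn_integral_cmult emeasure_space_1)
    also have "(\<integral>\<^sup>+\<omega>. smoothed S A b (Z \<omega>) \<partial>M) = (\<integral>\<^sup>+\<omega>. smoothed S A (2 * a) (drifted u \<omega>) \<partial>M)"
    proof -
      have "(\<integral>\<^sup>+\<omega>. smoothed S A b (Z \<omega>) \<partial>M) =
          (\<integral>\<^sup>+\<omega>. (\<integral>\<^sup>+w. ennreal (gauss (s - u) w) * smoothed S A b (drifted u \<omega> + S *v w) \<partial>lborel) \<partial>M)"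
        unfolding Z_def
        using nn_integral_indep_increment[OF u drifted_measurable_F[OF u(1)], of "\<lambda>(z, w). smoothed S A b (z + S *v w)"]
        by simp
      also have "\<dots> = (\<integral>\<^sup>+\<omega>. smoothed S A (2 * a) (drifted u \<omega>) \<partial>M)"
        using h a b by (simp add: smoothed_convolution u_def)
      finally show ?thesis .
    qed
    also have "ennreal tl * q + q * emeasure M E \<le> ennreal (c\<^sub>2 * sqrt a) * V"
    proof -
      have "emeasure M E \<le> ennreal (2 * tl)"
        using E(2) tail_h by (simp add: emeasure_eq_measure ennreal_leI)
      then have "ennreal tl * q + q * emeasure M E \<le> ennreal tl * q + q * ennreal (2 * tl)"
        by (intro add_left_mono mult_left_mono) auto
      also have "\<dots> = (ennreal tl + ennreal (2 * tl)) * ennreal (cv / sqrt a ^ CARD('d)) * V"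
        unfolding q_def by (simp add: algebra_simps)
      also have "(ennreal tl + ennreal (2 * tl)) * ennreal (cv / sqrt a ^ CARD('d)) = ennreal (3 * tl * (cv / sqrt a ^ CARD('d)))"
        using tl0 cv(1) a by (simp add: ennreal_plus[symmetric] ennreal_mult[symmetric] del: ennreal_plus)
      also have "\<dots> * V \<le> ennreal (c\<^sub>2 * sqrt a) * V"
      proof (intro mult_right_mono ennreal_leI)
        have "tl \<le> k * ((real m / \<kappa>) ^ m * a ^ m)"
          unfolding tl_def using exp_inverse_le_power[OF \<kappa> _ a(1), of m] k by (intro mult_left_mono) (auto simp: \<kappa>_def m_def)
        also have "\<dots> \<le> k * ((real m / \<kappa>) ^ m * sqrt a ^ m)"
        proof (intro mult_left_mono power_mono)
          have "a = sqrt a * sqrt a" using a by simp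
          also have "\<dots> \<le> sqrt a * 1" using sa by (intro mult_left_mono) auto
          finally show "a \<le> sqrt a" by simp
        qed (use a k \<kappa> in auto)
        finally have "3 * tl * (cv / sqrt a ^ CARD('d)) \<le> 3 * (k * ((real m / \<kappa>) ^ m * sqrt a ^ m)) * (cv / sqrt a ^ CARD('d))"
          using cv(1) a by (intro mult_right_mono) auto
        also have "\<dots> = c\<^sub>2 * sqrt a"
          unfolding c\<^sub>2_def m_def using sa by simp
        finally show "3 * tl * (cv / sqrt a ^ CARD('d)) \<le> c\<^sub>2 * sqrt a" .
      qed simp
      finally show ?thesis .
    qed
    finally show ?thesis unfolding u_def h_def V_def by (simp add: add_left_mono)
  qed
  then show ?thesis
    using \<delta> cv(1) k \<kappa> by (intro that[of \<delta> c c\<^sub>2]) (auto simp: c_def c\<^sub>2_def)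
qed

text \<open>The iteration runs from an arbitrarily small scale up to \<open>\<delta>\<close>, where \<open>smoothed_le_volume\<close>
  gives the initial bound; \<open>\<delta> \<le> t / 2\<close> leaves enough time. By Fatou's lemma the bound passes to the limit of
  vanishing smoothing.\<close>
lemma law_le_volume:
  assumes SR: "S ** R = mat 1" and r: "0 < r" and C: "0 \<le> C" and t: "0 < t"
    and drift: "AE \<omega> in M. \<forall>t\<ge>0. drifted t \<omega> \<in> ball x (3 * r) \<longrightarrow> norm (\<beta> t \<omega>) \<le> C"
  obtains K where "0 \<le> K"
    "\<And>A. open A \<Longrightarrow> A \<subseteq> ball x r \<Longrightarrow> emeasure M {\<omega> \<in> space M. drifted t \<omega> \<in> A} \<le> ennreal K * emeasure lborel A"
proof -
  obtain \<delta>' c c\<^sub>2 where \<delta>': "0 < \<delta>'" "\<delta>' \<le> 1" and c: "0 \<le> c" "0 \<le> c\<^sub>2"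
    and step: "\<And>a s A. 0 < a \<Longrightarrow> a \<le> \<delta>' \<Longrightarrow> a \<le> s \<Longrightarrow> A \<in> sets borel \<Longrightarrow> A \<subseteq> ball x r \<Longrightarrow>
      (\<integral>\<^sup>+\<omega>. smoothed S A a (drifted s \<omega>) \<partial>M) \<le>
        ennreal (exp (c * sqrt a)) * (\<integral>\<^sup>+\<omega>. smoothed S A (2 * a) (drifted (s - a * (1 - sqrt a)) \<omega>) \<partial>M)
        + ennreal (c\<^sub>2 * sqrt a) * emeasure lborel A"
    using one_scale_step[OF SR r C drift] by blast
  obtain cv where cv: "0 < cv" "\<And>A a z. A \<in> sets borel \<Longrightarrow> 0 < a \<Longrightarrow>
       smoothed S A a z \<le> ennreal (cv / sqrt a ^ CARD('d)) * emeasure lborel A"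
    using smoothed_le_volume[OF SR] by blast
  define \<delta> where "\<delta> = min \<delta>' (t / 2)"
  have \<delta>: "0 < \<delta>" "\<delta> \<le> 1" "\<delta> \<le> \<delta>'" "2 * \<delta> \<le> t" using \<delta>' t by (auto simp: \<delta>_def)
  define c\<^sub>0 where "c\<^sub>0 = cv / sqrt (\<delta> / 2) ^ CARD('d)"
  have c0: "0 \<le> c\<^sub>0" using cv \<delta> by (simp add: c\<^sub>0_def)
  define K where "K = exp ((c + 1) / (sqrt 2 - 1)) * (c\<^sub>0 + 2 * c\<^sub>2)"
  have "emeasure M {\<omega> \<in> space M. drifted t \<omega> \<in> A} \<le> ennreal K * emeasure lborel A"
    if A: "open A" "A \<subseteq> ball x r" for A
  proof -
    have [measurable]: "A \<in> sets borel" using A by simp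
    have [measurable]: "drifted t \<in> borel_measurable M" using t by simp
    let ?a = "\<lambda>k. inverse (real (Suc k))"
    have bound: "(\<integral>\<^sup>+\<omega>. smoothed S A a (drifted t \<omega>) \<partial>M) \<le> ennreal K * emeasure lborel A" if a: "0 < a" "a \<le> \<delta>" for a
      unfolding K_def
    proof (rule dyadic_iteration[where \<delta>=\<delta> and \<Phi>="\<lambda>a s. \<integral>\<^sup>+\<omega>. smoothed S A a (drifted s \<omega>) \<partial>M"])
      fix a s :: real assume a: "\<delta> / 2 < a" "a \<le> \<delta>" "a \<le> s"
      have "(\<integral>\<^sup>+\<omega>. smoothed S A a (drifted s \<omega>) \<partial>M) \<le> (\<integral>\<^sup>+\<omega>. ennreal c\<^sub>0 * emeasure lborel A \<partial>M)"
      proof (rule nn_integral_mono)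
        fix \<omega>
        have "smoothed S A a (drifted s \<omega>) \<le> ennreal (cv / sqrt a ^ CARD('d)) * emeasure lborel A"
          using a \<delta> by (intro cv) auto
        also have "\<dots> \<le> ennreal c\<^sub>0 * emeasure lborel A"
          unfolding c\<^sub>0_def using a \<delta> cv(1)
          by (intro mult_right_mono ennreal_leI divide_left_mono power_mono) auto
        finally show "smoothed S A a (drifted s \<omega>) \<le> ennreal c\<^sub>0 * emeasure lborel A" .
      qed
      then show "(\<integral>\<^sup>+\<omega>. smoothed S A a (drifted s \<omega>) \<partial>M) \<le> ennreal c\<^sub>0 * emeasure lborel A"
        by (simp add: emeasure_space_1)
    qed (use \<delta> c c0 A a in \<open>auto intro!: step\<close>)
    have ev: "\<forall>\<^sub>F k in sequentially. ?a k \<le> \<delta>"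
    proof -
      have "\<forall>\<^sub>F k in sequentially. ?a k < \<delta>"
        using LIMSEQ_inverse_real_of_nat \<delta>(1) by (rule order_tendstoD)
      then show ?thesis by eventually_elim simp
    qed
    have "emeasure M {\<omega> \<in> space M. drifted t \<omega> \<in> A} = (\<integral>\<^sup>+\<omega>. indicator {\<omega> \<in> space M. drifted t \<omega> \<in> A} \<omega> \<partial>M)"
      by (rule nn_integral_indicator[symmetric]) measurable
    also have "\<dots> \<le> (\<integral>\<^sup>+\<omega>. liminf (\<lambda>k. smoothed S A (?a k) (drifted t \<omega>)) \<partial>M)"
      using smoothed_liminf_ge_1_interior[of A _ S] A
      by (intro nn_integral_mono) (auto simp: indicator_def interior_open)
    also have "\<dots> \<le> liminf (\<lambda>k. \<integral>\<^sup>+\<omega>. smoothed S A (?a k) (drifted t \<omega>) \<partial>M)"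
      by (rule nn_integral_liminf) measurable
    also have "\<dots> \<le> liminf (\<lambda>k::nat. ennreal K * emeasure lborel A)"
      using ev by (intro Liminf_mono, elim eventually_mono) (rule bound, simp_all)
    also have "\<dots> = ennreal K * emeasure lborel A" by (simp add: Liminf_const)
    finally show ?thesis .
  qed
  then show ?thesis using c c0 by (intro that[of K]) (auto simp: K_def)
qed

end

section \<open>Differentiation of measures along cubes\<close>

text \<open>A finite measure has vanishing density at almost every point of a null set \<open>E\<close> of it. Suppose
  that on a subset of \<open>E\<close> arbitrarily small balls have measure at least \<open>\<alpha> r\<^sup>d\<close>. Cover \<open>E\<close> by an open
  set \<open>G\<close> of small \<open>\<nu>\<close>-measure, choose such balls inside \<open>G\<close>, and extract a disjoint family whose fivefold
  enlargements still cover: the Lebesgue measure of the subset is at most a constant times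
  \<open>\<nu> G / \<alpha>\<close>.\<close>
lemma measure_ball_ratio_tendsto_0_AE:
  fixes \<nu> :: "'b::euclidean_space measure"
  assumes fin: "finite_measure \<nu>" and sets[measurable_cong]: "sets \<nu> = sets borel"
    and E: "E \<in> sets borel" and null: "emeasure \<nu> E = 0"
  shows "AE x in lborel. x \<in> E \<longrightarrow> ((\<lambda>r. measure \<nu> (ball x r) / r ^ DIM('b)) \<longlongrightarrow> 0) (at_right 0)"
proof -
  interpret finite_measure \<nu> by fact
  define v where "v = unit_ball_vol (real DIM('b))"
  have v: "0 < v" by (simp add: v_def)
  define Bad where "Bad = (\<lambda>\<alpha>. {x \<in> E. \<forall>d>0. \<exists>r. 0 < r \<and> r < d \<and> \<alpha> * r ^ DIM('b) < measure \<nu> (ball x r)})"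
  have "negligible (Bad \<alpha>)" if \<alpha>: "0 < \<alpha>" for \<alpha>
    unfolding negligible_outer_le
  proof (intro allI impI)
    fix e :: real assume e: "0 < e"
    \<comment> \<open>fivefold enlarged balls have volume \<open>v 5\<^sup>d r\<^sup>d\<close>, so \<open>\<eta>\<close> turns into \<open>e\<close> at the end\<close>
    define \<eta> where "\<eta> = e * \<alpha> / (v * 5 ^ DIM('b))"
    have \<eta>: "0 < \<eta>" using e \<alpha> v by (simp add: \<eta>_def)
    have "(INF U \<in> {U. E \<subseteq> U \<and> open U}. emeasure \<nu> U) = 0"
      using outer_regular[OF sets _ E] null emeasure_finite by simp
    then have "(INF U \<in> {U. E \<subseteq> U \<and> open U}. emeasure \<nu> U) < ennreal \<eta>" using \<eta> by simp
    then obtain G where G: "E \<subseteq> G" "open G" "emeasure \<nu> G < ennreal \<eta>"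
      by (auto simp: INF_less_iff)
    have G\<eta>: "measure \<nu> G \<le> \<eta>"
      using G(3) \<eta> by (simp add: emeasure_eq_measure ennreal_less_iff)
    have "\<exists>r. 0 < r \<and> r \<le> 1 \<and> ball x r \<subseteq> G \<and> \<alpha> * r ^ DIM('b) < measure \<nu> (ball x r)" if x: "x \<in> Bad \<alpha>" for x
    proof -
      have "x \<in> G" using x G(1) by (auto simp: Bad_def)
      then obtain d where d: "0 < d" "ball x d \<subseteq> G" using G(2) by (meson open_contains_ball)
      then obtain r where "0 < r" "r < min d 1" "\<alpha> * r ^ DIM('b) < measure \<nu> (ball x r)"
        using x unfolding Bad_def by (auto dest!: spec[of _ "min d 1"])
      then show ?thesis using d by (intro exI[of _ r]) auto
    qed
    then obtain \<rho> where \<rho>: "\<And>x. x \<in> Bad \<alpha> \<Longrightarrow> 0 < \<rho> x \<and> \<rho> x \<le> 1"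
      "\<And>x. x \<in> Bad \<alpha> \<Longrightarrow> ball x (\<rho> x) \<subseteq> G"
      "\<And>x. x \<in> Bad \<alpha> \<Longrightarrow> \<alpha> * \<rho> x ^ DIM('b) < measure \<nu> (ball x (\<rho> x))"
      by metis
    have "Bad \<alpha> \<subseteq> (\<Union>x\<in>Bad \<alpha>. ball x (\<rho> x))" using \<rho>(1) by force
    then obtain C where C: "countable C" "C \<subseteq> Bad \<alpha>"
      "pairwise (\<lambda>i j. disjnt (ball i (\<rho> i)) (ball j (\<rho> j))) C" "Bad \<alpha> \<subseteq> (\<Union>i\<in>C. ball i (5 * \<rho> i))"
      by (rule Vitali_covering_lemma_balls[OF _ \<rho>(1)]) (assumption, blast)
    have fin_bound: "measure lebesgue (\<Union>i\<in>I. ball i (5 * \<rho> i)) \<le> e" if I: "I \<subseteq> C" "finite I" for I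
    proof -
      have I\<rho>: "0 < \<rho> i" "ball i (\<rho> i) \<subseteq> G" "\<alpha> * \<rho> i ^ DIM('b) < measure \<nu> (ball i (\<rho> i))" if "i \<in> I" for i
        using \<rho>[of i] that I(1) C(2) by blast+
      have "measure lebesgue (\<Union>i\<in>I. ball i (5 * \<rho> i)) \<le> (\<Sum>i\<in>I. measure lebesgue (ball i (5 * \<rho> i)))"
        using I(2) by (intro measure_UNION_le) auto
      also have "\<dots> = (\<Sum>i\<in>I. v * 5 ^ DIM('b) * \<rho> i ^ DIM('b))"
        using I\<rho>(1) by (intro sum.cong refl) (simp add: content_ball less_imp_le v_def power_mult_distrib)
      also have "\<dots> \<le> (\<Sum>i\<in>I. v * 5 ^ DIM('b) / \<alpha> * measure \<nu> (ball i (\<rho> i)))"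
      proof (rule sum_mono)
        fix i assume "i \<in> I"
        from I\<rho>(3)[OF this] have "\<rho> i ^ DIM('b) \<le> measure \<nu> (ball i (\<rho> i)) / \<alpha>"
          using \<alpha> by (simp add: field_simps)
        from mult_left_mono[OF this, of "v * 5 ^ DIM('b)"]
        show "v * 5 ^ DIM('b) * \<rho> i ^ DIM('b) \<le> v * 5 ^ DIM('b) / \<alpha> * measure \<nu> (ball i (\<rho> i))"
          using v by simp
      qed
      also have "\<dots> = v * 5 ^ DIM('b) / \<alpha> * measure \<nu> (\<Union>i\<in>I. ball i (\<rho> i))"
      proof -
        have "disjoint_family_on (\<lambda>i. ball i (\<rho> i)) I"
          using C(3) I(1) by (auto simp: disjoint_family_on_def pairwise_def disjnt_def)
        then show ?thesis
          using I(2) by (subst finite_measure_finite_Union) (auto simp: sum_distrib_left sets)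
      qed
      also have "\<dots> \<le> v * 5 ^ DIM('b) / \<alpha> * \<eta>"
      proof (rule mult_left_mono)
        have "measure \<nu> (\<Union>i\<in>I. ball i (\<rho> i)) \<le> measure \<nu> G"
          using I\<rho>(2) G(2) by (intro finite_measure_mono) (auto simp: sets)
        then show "measure \<nu> (\<Union>i\<in>I. ball i (\<rho> i)) \<le> \<eta>" using G\<eta> by simp
      qed (use v \<alpha> in auto)
      also have "\<dots> = e" using v \<alpha> by (simp add: \<eta>_def)
      finally show ?thesis .
    qed
    have "(\<Union>i\<in>C. ball i (5 * \<rho> i)) \<in> lmeasurable \<and> measure lebesgue (\<Union>i\<in>C. ball i (5 * \<rho> i)) \<le> e"
      using fmeasurable_UN_bound[OF C(1), of "\<lambda>i. ball i (5 * \<rho> i)" lebesgue e]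
        measure_UN_bound[OF C(1), of "\<lambda>i. ball i (5 * \<rho> i)" lebesgue e] fin_bound by auto
    then show "\<exists>T. Bad \<alpha> \<subseteq> T \<and> T \<in> lmeasurable \<and> measure lebesgue T \<le> e"
      using C(4) by blast
  qed
  then have "negligible (\<Union>n. Bad (inverse (real (Suc n))))"
    by (intro negligible_countable_Union) auto
  then have "AE x in lebesgue. x \<notin> (\<Union>n. Bad (inverse (real (Suc n))))"
    by (intro AE_not_in) (simp add: negligible_iff_null_sets)
  then have "AE x in lborel. x \<notin> (\<Union>n. Bad (inverse (real (Suc n))))"
    by (simp add: AE_completion_iff)
  then show ?thesis
  proof eventually_elim
    case (elim x)
    show ?case
    proof
      assume x: "x \<in> E"
      show "((\<lambda>r. measure \<nu> (ball x r) / r ^ DIM('b)) \<longlongrightarrow> 0) (at_right 0)"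
      proof (rule tendstoI)
        fix \<epsilon> :: real assume "0 < \<epsilon>"
        then obtain n where n: "inverse (real (Suc n)) < \<epsilon>" using reals_Archimedean by blast
        from elim have "x \<notin> Bad (inverse (real (Suc n)))" by blast
        with x obtain d where d: "0 < d"
          "\<forall>r. \<not> (0 < r \<and> r < d \<and> inverse (real (Suc n)) * r ^ DIM('b) < measure \<nu> (ball x r))"
          unfolding Bad_def by blast
        have "dist (measure \<nu> (ball x r) / r ^ DIM('b)) 0 < \<epsilon>" if "0 < r" "r < d" for r
        proof -
          have "measure \<nu> (ball x r) / r ^ DIM('b) \<le> inverse (real (Suc n))"
          proof -
            have "\<not> inverse (real (Suc n)) * r ^ DIM('b) < measure \<nu> (ball x r)" using d(2) that by blast
            then show ?thesis
              using \<open>0 < r\<close> by (subst pos_divide_le_eq) (auto simp only: not_less zero_less_power)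
          qed
          then show ?thesis using n that by simp
        qed
        then show "\<forall>\<^sub>F r in at_right 0. dist (measure \<nu> (ball x r) / r ^ DIM('b)) 0 < \<epsilon>"
          using d(1) unfolding eventually_at_right_field by blast
      qed
    qed
  qed
qed

lemma infnorm_less_iff: "infnorm (x :: real^'d) < e \<longleftrightarrow> (\<forall>j. \<bar>x $ j\<bar> < e)"
  by (auto simp: infnorm_Max Basis_vec_def inner_axis)

lemma sup_ball_eq_infnorm: "sup_ball e x = {y. infnorm (y - x) < e}"
  by (auto simp: sup_ball_def infnorm_less_iff abs_less_iff) (smt (verit))+

lemma sup_ball_eq_box: "sup_ball e (x :: real^'d) = box (\<chi> j. x $ j - e) (\<chi> j. x $ j + e)"
  by (auto simp: sup_ball_def mem_box_cart)

lemma open_sup_ball [simp]: "open (sup_ball e x)"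
  by (simp add: sup_ball_eq_box open_box)

lemma emeasure_sup_ball:
  assumes "0 < e"
  shows "emeasure lborel (sup_ball e (x :: real^'d)) = ennreal ((2 * e) ^ CARD('d))"
proof -
  let ?l = "\<chi> j. x $ j - e" and ?u = "\<chi> j. x $ j + e"
  have diff: "?u \<bullet> b - ?l \<bullet> b = 2 * e" if "b \<in> Basis" for b
    using that by (auto simp: Basis_vec_def inner_axis)
  have "?l \<bullet> b \<le> ?u \<bullet> b" if "b \<in> Basis" for b
    using diff[OF that] assms by linarith
  then have "emeasure lborel (box ?l ?u) = (\<Prod>b\<in>Basis. (?u - ?l) \<bullet> b)"
    by (rule emeasure_lborel_box)
  also have "(\<Prod>b\<in>Basis. (?u - ?l) \<bullet> b) = (\<Prod>b\<in>(Basis :: (real^'d) set). 2 * e)"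
    by (intro prod.cong refl) (simp add: inner_diff_left diff)
  finally show ?thesis by (simp add: sup_ball_eq_box)
qed

text \<open>Coarse in the constant, but enough to compare cubes with balls of the Vitali covering lemma.\<close>
lemma sup_ball_subset_ball:
  fixes x :: "real^'d"
  assumes "0 < e"
  shows "sup_ball e x \<subseteq> ball x (real CARD('d) * e)"
proof
  fix y assume "y \<in> sup_ball e x"
  then have *: "\<bar>(y - x) $ j\<bar> < e" for j by (auto simp: sup_ball_eq_infnorm infnorm_less_iff)
  have "norm (y - x) \<le> (\<Sum>j\<in>UNIV. \<bar>(y - x) $ j\<bar>)" by (rule norm_le_l1_cart)
  also have "\<dots> < real CARD('d) * e"
    by (rule sum_bounded_above_strict) (use * in auto)
  finally show "y \<in> ball x (real CARD('d) * e)" by (simp add: dist_norm norm_minus_commute)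
qed

lemma eventually_sup_ball_subset:
  assumes "open G" "x \<in> G"
  shows "\<forall>\<^sub>F e in at_right 0. sup_ball e (x :: real^'d) \<subseteq> G"
proof -
  obtain d where d: "0 < d" "ball x d \<subseteq> G" using assms by (auto simp: open_contains_ball)
  have "sup_ball e x \<subseteq> G" if "0 < e" "e < d / real CARD('d)" for e
  proof -
    have "real CARD('d) * e \<le> d" using that by (simp add: field_simps)
    then show ?thesis using sup_ball_subset_ball[OF that(1), of x] d(2) by (meson order_trans subset_ball)
  qed
  then show ?thesis
    using d unfolding eventually_at_right_field by (intro exI[of _ "d / real CARD('d)"]) auto
qed

text \<open>The function \<open>limsup_density\<close> as a function of the law alone, with the volume of the cube
  written out.\<close>
definition cube_density :: "(real^'d) measure \<Rightarrow> real^'d \<Rightarrow> ennreal" where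
  "cube_density \<mu> x = Limsup (at_right 0) (\<lambda>e. ennreal (measure \<mu> (sup_ball e x) / (2 * e) ^ CARD('d)))"

text \<open>For fixed \<open>e\<close> the measure of the open cube is a lower semicontinuous function of its centre, and
  this property is inherited by arbitrary suprema. So the uncountable supremum over small \<open>e\<close> is
  Borel measurable, and the upper limit is a countable infimum of such functions.\<close>
lemma borel_measurable_cube_density:
  fixes \<mu> :: "(real^'d) measure"
  assumes fin: "finite_measure \<mu>" and sets[simp]: "sets \<mu> = sets borel"
  shows "cube_density \<mu> \<in> borel_measurable borel"
proof -
  interpret finite_measure \<mu> by fact
  define q where "q = (\<lambda>e x. ennreal (measure \<mu> (sup_ball e x) / (2 * e) ^ CARD('d)))"
  have lower: "open {x. y < q e x}" if e: "0 < e" for y e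
  proof (rule openI)
    fix x assume x: "x \<in> {x. y < q e x}"
    define r where "r = (\<lambda>k. e - e * inverse (real (Suc k)))"
    have r: "r k < e" for k using e by (simp add: r_def)
    have "incseq (\<lambda>k. sup_ball (r k) x)"
      unfolding incseq_def sup_ball_eq_infnorm using e
      by (auto simp: r_def intro!: less_le_trans[where z="e - e * _"] mult_left_mono le_imp_inverse_le)
    moreover have "(\<Union>k. sup_ball (r k) x) = sup_ball e x"
    proof safe
      fix z assume "z \<in> sup_ball e x"
      then have "infnorm (z - x) < e" by (simp add: sup_ball_eq_infnorm)
      moreover have "(\<lambda>k. r k) \<longlonglongrightarrow> e - e * 0"
        unfolding r_def by (intro tendsto_intros LIMSEQ_inverse_real_of_nat)
      ultimately have "\<forall>\<^sub>F k in sequentially. infnorm (z - x) < r k"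
        by (intro order_tendstoD) auto
      then show "z \<in> (\<Union>k. sup_ball (r k) x)"
        by (auto simp: sup_ball_eq_infnorm eventually_sequentially)
    next
      fix z k assume "z \<in> sup_ball (r k) x"
      then show "z \<in> sup_ball e x" using r[of k] by (auto simp: sup_ball_eq_infnorm)
    qed
    moreover have "range (\<lambda>k. sup_ball (r k) x) \<subseteq> sets \<mu>" by (auto intro!: borel_open)
    ultimately have "(\<lambda>k. measure \<mu> (sup_ball (r k) x)) \<longlonglongrightarrow> measure \<mu> (sup_ball e x)"
      using finite_Lim_measure_incseq[of "\<lambda>k. sup_ball (r k) x"] by simp
    then have "(\<lambda>k. ennreal (measure \<mu> (sup_ball (r k) x) / (2 * e) ^ CARD('d))) \<longlonglongrightarrow> q e x"
      unfolding q_def using e by (intro tendsto_ennrealI tendsto_divide tendsto_const) auto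
    then have "\<forall>\<^sub>F k in sequentially. y < ennreal (measure \<mu> (sup_ball (r k) x) / (2 * e) ^ CARD('d))"
      using x by (intro order_tendstoD) auto
    then obtain k where k: "y < ennreal (measure \<mu> (sup_ball (r k) x) / (2 * e) ^ CARD('d))"
      by (auto simp: eventually_sequentially)
    have "y < q e z" if z: "z \<in> ball x (e - r k)" for z
    proof -
      have "sup_ball (r k) x \<subseteq> sup_ball e z"
      proof
        fix w assume w: "w \<in> sup_ball (r k) x"
        have "infnorm (w - z) \<le> infnorm (w - x) + infnorm (x - z)"
          using infnorm_triangle[of "w - x" "x - z"] by simp
        also have "infnorm (x - z) \<le> norm (x - z)" by (rule infnorm_le_norm)
        finally show "w \<in> sup_ball e z" using w z by (simp add: sup_ball_eq_infnorm dist_norm)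
      qed
      then have "measure \<mu> (sup_ball (r k) x) \<le> measure \<mu> (sup_ball e z)"
        by (intro finite_measure_mono) auto
      then have "ennreal (measure \<mu> (sup_ball (r k) x) / (2 * e) ^ CARD('d)) \<le> q e z"
        unfolding q_def using e by (intro ennreal_leI divide_right_mono) auto
      then show ?thesis using k by simp
    qed
    then show "\<exists>d>0. ball x d \<subseteq> {x. y < q e x}"
      using r[of k] by (intro exI[of _ "e - r k"]) auto
  qed
  define s where "s = (\<lambda>d x. SUP e\<in>{0<..<d}. q e x)"
  have s_meas[measurable]: "s d \<in> borel_measurable borel" for d
  proof (rule borel_measurableI_greater)
    fix y
    have "{x \<in> space borel. y < s d x} = (\<Union>e\<in>{0<..<d}. {x. y < q e x})"
      by (auto simp: s_def less_SUP_iff)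
    then show "{x \<in> space borel. y < s d x} \<in> sets borel"
      using lower by (auto intro!: borel_open open_UN)
  qed
  have "cube_density \<mu> x = (INF n. s (inverse (real (Suc n))) x)" for x
  proof (rule antisym)
    show "cube_density \<mu> x \<le> (INF n. s (inverse (real (Suc n))) x)"
    proof (rule INF_greatest)
      fix n
      have "\<forall>\<^sub>F e in at_right (0::real). e \<in> {0<..<inverse (real (Suc n))}"
        by (rule eventually_at_right_real) simp
      then have "\<forall>\<^sub>F e in at_right (0::real). q e x \<le> s (inverse (real (Suc n))) x"
        by eventually_elim (auto simp: s_def intro: SUP_upper)
      then show "cube_density \<mu> x \<le> s (inverse (real (Suc n))) x"
        unfolding cube_density_def q_def by (rule Limsup_bounded)
    qed
  next
    show "(INF n. s (inverse (real (Suc n))) x) \<le> cube_density \<mu> x"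
      unfolding cube_density_def Limsup_def
    proof (rule INF_greatest, clarify)
      fix P assume "eventually P (at_right (0::real))"
      then obtain b where b: "0 < b" "\<And>e. 0 < e \<Longrightarrow> e < b \<Longrightarrow> P e"
        unfolding eventually_at_right_field by blast
      obtain n where n: "inverse (real (Suc n)) < b" using reals_Archimedean b(1) by blast
      have "s (inverse (real (Suc n))) x \<le> (SUP e\<in>Collect P. q e x)"
        unfolding s_def using b n by (intro SUP_subset_mono) auto
      then show "(INF n. s (inverse (real (Suc n))) x) \<le> (SUP e\<in>Collect P. ennreal (measure \<mu> (sup_ball e x) / (2 * e) ^ CARD('d)))"
        unfolding q_def by (rule INF_lower2[OF UNIV_I])
    qed
  qed
  then have "cube_density \<mu> = (\<lambda>x. INF n. s (inverse (real (Suc n))) x)" by auto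
  then show ?thesis by simp
qed


text \<open>Split the cube into its part in \<open>E\<close>, where the measure is at most \<open>c\<close> times Lebesgue measure,
  and the part outside \<open>E\<close>. The latter is charged by a measure that vanishes on \<open>E\<close> and hence has
  density zero at almost all points of \<open>E\<close>. Cubes are compared with balls, which costs only a constant.\<close>
lemma cube_density_le_on_sublevel:
  fixes \<mu> :: "(real^'d) measure"
  assumes fin: "finite_measure \<mu>" and sets[measurable_cong, simp]: "sets \<mu> = sets borel"
    and E[measurable]: "E \<in> sets borel" and c: "0 \<le> c"
    and le: "\<And>A. A \<in> sets borel \<Longrightarrow> A \<subseteq> E \<Longrightarrow> emeasure \<mu> A \<le> ennreal c * emeasure lborel A"
  shows "AE x in lborel. x \<in> E \<longrightarrow> cube_density \<mu> x \<le> ennreal c"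
proof -
  interpret finite_measure \<mu> by fact
  define \<nu> where "\<nu> = density \<mu> (indicator (- E))"
  have \<nu>_eq: "emeasure \<nu> A = emeasure \<mu> (A - E)" if "A \<in> sets borel" for A
    using that by (simp add: \<nu>_def emeasure_restricted Diff_eq Int_commute)
  have sets\<nu>: "sets \<nu> = sets borel" by (simp add: \<nu>_def)
  have fin\<nu>: "finite_measure \<nu>"
    by (rule finite_measureI) (simp add: \<nu>_eq sets_eq_imp_space_eq[OF sets\<nu>])
  have m\<nu>: "measure \<nu> A = measure \<mu> (A - E)" if "A \<in> sets borel" for A
    by (simp add: measure_def \<nu>_eq that)
  have "emeasure \<nu> E = 0" by (simp add: \<nu>_eq)
  from measure_ball_ratio_tendsto_0_AE[OF fin\<nu> sets\<nu> E this]
  show ?thesis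
  proof eventually_elim
    case (elim x)
    show ?case
    proof
      assume "x \<in> E"
      with elim have lim: "((\<lambda>r. measure \<nu> (ball x r) / r ^ CARD('d)) \<longlongrightarrow> 0) (at_right 0)" by simp
      define D where "D = real CARD('d)"
      have D: "0 < D" by (simp add: D_def)
      have "filterlim (\<lambda>e. D * e) (at_right 0) (at_right 0)"
        unfolding filterlim_at using D
        by (auto intro!: tendsto_eq_intros simp: eventually_at_filter)
      from filterlim_compose[OF lim this]
      have "((\<lambda>e. measure \<nu> (ball x (D * e)) / (D * e) ^ CARD('d)) \<longlongrightarrow> 0) (at_right 0)" .
      then have lim2: "((\<lambda>e. c + (D / 2) ^ CARD('d) * (measure \<nu> (ball x (D * e)) / (D * e) ^ CARD('d))) \<longlongrightarrow> c + (D / 2) ^ CARD('d) * 0) (at_right 0)"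
        by (intro tendsto_intros)
      have bound: "ennreal (measure \<mu> (sup_ball e x) / (2 * e) ^ CARD('d)) \<le>
          ennreal (c + (D / 2) ^ CARD('d) * (measure \<nu> (ball x (D * e)) / (D * e) ^ CARD('d)))" if e: "0 < e" for e
      proof (rule ennreal_leI)
        have "measure \<mu> (sup_ball e x) = measure \<mu> (sup_ball e x \<inter> E) + measure \<mu> (sup_ball e x - E)"
          by (subst finite_measure_Union[symmetric]) (auto intro!: arg_cong[where f="measure \<mu>"] borel_open)
        also have "measure \<mu> (sup_ball e x \<inter> E) \<le> c * (2 * e) ^ CARD('d)"
        proof -
          have "emeasure \<mu> (sup_ball e x \<inter> E) \<le> ennreal c * emeasure lborel (sup_ball e x \<inter> E)"
            by (intro le) (auto intro!: sets.Int borel_open)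
          also have "\<dots> \<le> ennreal c * emeasure lborel (sup_ball e x)"
            by (intro mult_left_mono emeasure_mono) (auto intro: borel_open)
          also have "\<dots> = ennreal (c * (2 * e) ^ CARD('d))"
            using c e by (simp add: emeasure_sup_ball ennreal_mult)
          finally show ?thesis
            using c e by (simp add: emeasure_eq_measure)
        qed
        also have "measure \<mu> (sup_ball e x - E) \<le> measure \<nu> (ball x (D * e))"
        proof -
          have "measure \<mu> (sup_ball e x - E) = measure \<nu> (sup_ball e x)"
            by (simp add: m\<nu> borel_open)
          also have "\<dots> \<le> measure \<nu> (ball x (D * e))"
            using sup_ball_subset_ball[OF e, of x] finite_measure.finite_measure_mono[OF fin\<nu>]
            by (simp add: D_def sets\<nu>)
          finally show ?thesis .
        qed
        finally have "measure \<mu> (sup_ball e x) / (2 * e) ^ CARD('d) \<le>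
            (c * (2 * e) ^ CARD('d) + measure \<nu> (ball x (D * e))) / (2 * e) ^ CARD('d)"
          using e by (simp add: divide_right_mono)
        also have "\<dots> = c + (D / 2) ^ CARD('d) * (measure \<nu> (ball x (D * e)) / (D * e) ^ CARD('d))"
          using e D by (simp add: add_divide_distrib power_mult_distrib power_divide)
        finally show "measure \<mu> (sup_ball e x) / (2 * e) ^ CARD('d) \<le>
            c + (D / 2) ^ CARD('d) * (measure \<nu> (ball x (D * e)) / (D * e) ^ CARD('d))" by simp
      qed
      have "cube_density \<mu> x \<le> Limsup (at_right 0) (\<lambda>e. ennreal (c + (D / 2) ^ CARD('d) * (measure \<nu> (ball x (D * e)) / (D * e) ^ CARD('d))))"
        unfolding cube_density_def
        using bound by (intro Limsup_mono) (auto simp: eventually_at_right_field intro: exI[of _ 1])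
      also have "\<dots> = ennreal (c + (D / 2) ^ CARD('d) * 0)"
        using tendsto_ennrealI[OF lim2] by (intro lim_imp_Limsup) auto
      finally show "cube_density \<mu> x \<le> ennreal c" by simp
    qed
  qed
qed

text \<open>The same idea with the roles exchanged: the part of the cube outside \<open>E\<close> is negligible in
  volume, because Lebesgue measure restricted to the complement of \<open>E\<close> vanishes on \<open>E\<close>. The restriction to
  bounded balls makes these measures finite.\<close>
lemma cube_density_ge_on_superlevel:
  fixes \<mu> :: "(real^'d) measure"
  assumes fin: "finite_measure \<mu>" and sets[measurable_cong, simp]: "sets \<mu> = sets borel"
    and E[measurable]: "E \<in> sets borel" and c: "0 \<le> c"
    and ge: "\<And>A. A \<in> sets borel \<Longrightarrow> A \<subseteq> E \<Longrightarrow> ennreal c * emeasure lborel A \<le> emeasure \<mu> A"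
  shows "AE x in lborel. x \<in> E \<longrightarrow> ennreal c \<le> cube_density \<mu> x"
proof -
  interpret finite_measure \<mu> by fact
  define \<nu> where "\<nu> = (\<lambda>n::nat. density lborel (indicator (ball (0::real^'d) (real n) - E)) :: (real^'d) measure)"
  have \<nu>_eq: "emeasure (\<nu> n) A = emeasure lborel (A \<inter> (ball 0 (real n) - E))" if "A \<in> sets borel" for A n
    using that by (simp add: \<nu>_def emeasure_restricted Int_commute)
  have sets\<nu>: "sets (\<nu> n) = sets borel" for n by (simp add: \<nu>_def)
  have fin\<nu>: "finite_measure (\<nu> n)" for n
  proof (rule finite_measureI)
    have "emeasure (\<nu> n) (space (\<nu> n)) \<le> emeasure lborel (ball (0::real^'d) (real n))"
      by (simp add: \<nu>_eq sets_eq_imp_space_eq[OF sets\<nu>]) (intro emeasure_mono, auto)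
    also have "\<dots> < \<infinity>" by (rule emeasure_lborel_ball_finite)
    finally show "emeasure (\<nu> n) (space (\<nu> n)) \<noteq> \<infinity>" by simp
  qed
  have null: "emeasure (\<nu> n) E = 0" for n
    using \<nu>_eq[OF E, of n] by (simp add: Int_Diff)
  have "AE x in lborel. \<forall>n. x \<in> E \<longrightarrow> ((\<lambda>r. measure (\<nu> n) (ball x r) / r ^ DIM(real^'d)) \<longlongrightarrow> 0) (at_right 0)"
    unfolding AE_all_countable
    using measure_ball_ratio_tendsto_0_AE[OF fin\<nu> sets\<nu> E null] by blast
  then show ?thesis
  proof eventually_elim
    case (elim x)
    show ?case
    proof
      assume x: "x \<in> E"
      obtain n where n: "norm x < real n" using reals_Archimedean2 by blast
      from elim x have lim: "((\<lambda>r. measure (\<nu> n) (ball x r) / r ^ CARD('d)) \<longlongrightarrow> 0) (at_right 0)" by simp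
      define D where "D = real CARD('d)"
      have D: "0 < D" by (simp add: D_def)
      have "filterlim (\<lambda>e. D * e) (at_right 0) (at_right 0)"
        unfolding filterlim_at using D
        by (auto intro!: tendsto_eq_intros simp: eventually_at_filter)
      from filterlim_compose[OF lim this]
      have "((\<lambda>e. measure (\<nu> n) (ball x (D * e)) / (D * e) ^ CARD('d)) \<longlongrightarrow> 0) (at_right 0)" .
      then have lim2: "((\<lambda>e. c - c * (D / 2) ^ CARD('d) * (measure (\<nu> n) (ball x (D * e)) / (D * e) ^ CARD('d))) \<longlongrightarrow> c - c * (D / 2) ^ CARD('d) * 0) (at_right 0)"
        by (intro tendsto_intros)
      have inside: "\<forall>\<^sub>F e in at_right 0. sup_ball e x \<subseteq> ball 0 (real n)"
        using n by (intro eventually_sup_ball_subset) auto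
      have bound: "ennreal (c - c * (D / 2) ^ CARD('d) * (measure (\<nu> n) (ball x (D * e)) / (D * e) ^ CARD('d)))
          \<le> ennreal (measure \<mu> (sup_ball e x) / (2 * e) ^ CARD('d))"
        if e: "0 < e" and ins: "sup_ball e x \<subseteq> ball 0 (real n)" for e
      proof (rule ennreal_leI)
        let ?Q = "sup_ball e x"
        have Q[measurable]: "?Q \<in> sets borel" by (simp add: borel_open)
        have fQ: "emeasure lborel (?Q \<inter> B) \<noteq> \<infinity>" if "B \<in> sets borel" for B
        proof -
          have "emeasure lborel (?Q \<inter> B) \<le> emeasure lborel ?Q" by (intro emeasure_mono) auto
          also have "\<dots> < \<infinity>" using e by (simp add: emeasure_sup_ball)
          finally show ?thesis by simp
        qed
        have split: "(2 * e) ^ CARD('d) = measure lborel (?Q \<inter> E) + measure lborel (?Q - E)"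
        proof -
          have "(2 * e) ^ CARD('d) = measure lborel ?Q" using e by (simp add: measure_def emeasure_sup_ball)
          also have "?Q = (?Q \<inter> E) \<union> (?Q - E)" by auto
          also have "measure lborel \<dots> = measure lborel (?Q \<inter> E) + measure lborel (?Q - E)"
            using fQ[of E] fQ[of "- E"] by (intro measure_Union) (auto simp: Diff_eq)
          finally show ?thesis .
        qed
        have "ennreal c * emeasure lborel (?Q \<inter> E) \<le> emeasure \<mu> (?Q \<inter> E)" by (intro ge) auto
        also have "\<dots> \<le> emeasure \<mu> ?Q" by (intro emeasure_mono) auto
        finally have "c * measure lborel (?Q \<inter> E) \<le> measure \<mu> ?Q"
          using fQ[OF E] c by (simp add: emeasure_eq_ennreal_measure emeasure_eq_measure ennreal_mult[symmetric])
        moreover have "measure lborel (?Q - E) \<le> measure (\<nu> n) (ball x (D * e))"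
        proof -
          have "?Q \<inter> (ball 0 (real n) - E) = ?Q - E" using ins by auto
          then have "measure lborel (?Q - E) = measure (\<nu> n) ?Q"
            using \<nu>_eq[OF Q, of n] by (simp add: measure_def)
          also have "\<dots> \<le> measure (\<nu> n) (ball x (D * e))"
            using sup_ball_subset_ball[OF e, of x] finite_measure.finite_measure_mono[OF fin\<nu>]
            by (simp add: D_def sets\<nu>)
          finally show ?thesis .
        qed
        then have "c * measure lborel (?Q - E) \<le> c * measure (\<nu> n) (ball x (D * e))"
          using c by (rule mult_left_mono)
        ultimately have "c * (2 * e) ^ CARD('d) - c * measure (\<nu> n) (ball x (D * e)) \<le> measure \<mu> ?Q"
          unfolding split distrib_left by linarith
        then have "(c * (2 * e) ^ CARD('d) - c * measure (\<nu> n) (ball x (D * e))) / (2 * e) ^ CARD('d)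
            \<le> measure \<mu> ?Q / (2 * e) ^ CARD('d)"
          using e by (intro divide_right_mono) auto
        moreover have "(c * (2 * e) ^ CARD('d) - c * measure (\<nu> n) (ball x (D * e))) / (2 * e) ^ CARD('d) =
            c - c * (D / 2) ^ CARD('d) * (measure (\<nu> n) (ball x (D * e)) / (D * e) ^ CARD('d))"
          using e D by (simp add: diff_divide_distrib power_mult_distrib power_divide)
        ultimately show "c - c * (D / 2) ^ CARD('d) * (measure (\<nu> n) (ball x (D * e)) / (D * e) ^ CARD('d))
            \<le> measure \<mu> ?Q / (2 * e) ^ CARD('d)" by simp
      qed
      have pos: "\<forall>\<^sub>F e in at_right (0::real). 0 < e" by (simp add: eventually_at_right_less)
      have ev: "\<forall>\<^sub>F e in at_right 0. ennreal (c - c * (D / 2) ^ CARD('d) * (measure (\<nu> n) (ball x (D * e)) / (D * e) ^ CARD('d)))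
          \<le> ennreal (measure \<mu> (sup_ball e x) / (2 * e) ^ CARD('d))"
        using inside pos by eventually_elim (rule bound)
      have "ennreal c = Limsup (at_right 0) (\<lambda>e. ennreal (c - c * (D / 2) ^ CARD('d) * (measure (\<nu> n) (ball x (D * e)) / (D * e) ^ CARD('d))))"
        using tendsto_ennrealI[OF lim2] by (subst lim_imp_Limsup) auto
      also have "\<dots> \<le> cube_density \<mu> x"
        unfolding cube_density_def using ev by (rule Limsup_mono)
      finally show "ennreal c \<le> cube_density \<mu> x" .
    qed
  qed
qed

text \<open>Lebesgue's differentiation theorem for centred cubes. Sublevel and superlevel sets of \<open>f\<close> at
  rational levels reduce it to the two preceding lemmas: if the cube density and \<open>f\<close> differed at a point,
  a rational number would lie strictly between them.\<close>
lemma cube_density_eq_density_AE: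
  fixes \<mu> :: "(real^'d) measure"
  assumes fin: "finite_measure \<mu>" and sets: "sets \<mu> = sets borel"
    and U[measurable]: "U \<in> sets borel" and f[measurable]: "f \<in> borel_measurable borel"
    and density: "\<And>A. A \<in> sets borel \<Longrightarrow> A \<subseteq> U \<Longrightarrow> emeasure \<mu> A = (\<integral>\<^sup>+x\<in>A. f x \<partial>lborel)"
  shows "AE x in lborel. x \<in> U \<longrightarrow> cube_density \<mu> x = f x"
proof -
  let ?c = "\<lambda>q::rat. max 0 (real_of_rat q)"
  have le: "AE x in lborel. x \<in> {x \<in> U. f x \<le> ennreal (?c q)} \<longrightarrow> cube_density \<mu> x \<le> ennreal (?c q)" for q
  proof (rule cube_density_le_on_sublevel[OF fin sets])
    fix A assume A: "A \<in> sets borel" "A \<subseteq> {x \<in> U. f x \<le> ennreal (?c q)}"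
    note A(1)[measurable]
    have "emeasure \<mu> A = (\<integral>\<^sup>+x\<in>A. f x \<partial>lborel)" using A by (intro density) auto
    also have "\<dots> \<le> (\<integral>\<^sup>+x. ennreal (?c q) * indicator A x \<partial>lborel)"
      using A(2) by (intro nn_integral_mono) (auto split: split_indicator)
    also have "\<dots> = ennreal (?c q) * emeasure lborel A" by (rule nn_integral_cmult_indicator) simp
    finally show "emeasure \<mu> A \<le> ennreal (?c q) * emeasure lborel A" .
  qed auto
  have ge: "AE x in lborel. x \<in> {x \<in> U. ennreal (?c q) \<le> f x} \<longrightarrow> ennreal (?c q) \<le> cube_density \<mu> x" for q
  proof (rule cube_density_ge_on_superlevel[OF fin sets])
    fix A assume A: "A \<in> sets borel" "A \<subseteq> {x \<in> U. ennreal (?c q) \<le> f x}"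
    note A(1)[measurable]
    have "ennreal (?c q) * emeasure lborel A = (\<integral>\<^sup>+x. ennreal (?c q) * indicator A x \<partial>lborel)"
      by (rule nn_integral_cmult_indicator[symmetric]) simp
    also have "\<dots> \<le> (\<integral>\<^sup>+x\<in>A. f x \<partial>lborel)"
      using A(2) by (intro nn_integral_mono) (auto split: split_indicator)
    also have "\<dots> = emeasure \<mu> A" using A by (intro density[symmetric]) auto
    finally show "ennreal (?c q) * emeasure lborel A \<le> emeasure \<mu> A" .
  qed auto
  have "AE x in lborel. \<forall>q. (x \<in> {x \<in> U. f x \<le> ennreal (?c q)} \<longrightarrow> cube_density \<mu> x \<le> ennreal (?c q)) \<and>
     (x \<in> {x \<in> U. ennreal (?c q) \<le> f x} \<longrightarrow> ennreal (?c q) \<le> cube_density \<mu> x)"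
    unfolding AE_all_countable using le ge by (intro allI AE_conjI) auto
  then show ?thesis
  proof eventually_elim
    case (elim x)
    show ?case
    proof (intro impI antisym)
      assume x: "x \<in> U"
      have c: "ennreal (?c q) = ennreal (real_of_rat q)" for q
        by (simp add: max_def ennreal_neg)
      show "cube_density \<mu> x \<le> f x"
      proof (rule ccontr)
        assume "\<not> cube_density \<mu> x \<le> f x"
        then obtain q where "f x < ennreal (real_of_rat q)" "ennreal (real_of_rat q) < cube_density \<mu> x"
          using ennreal_rat_dense[of "f x" "cube_density \<mu> x"] by (auto simp: not_le)
        then show False using elim[rule_format, of q] x unfolding c by auto
      qed
      show "f x \<le> cube_density \<mu> x"
      proof (rule ccontr)
        assume "\<not> f x \<le> cube_density \<mu> x"
        then obtain q where "cube_density \<mu> x < ennreal (real_of_rat q)" "ennreal (real_of_rat q) < f x"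
          using ennreal_rat_dense[of "cube_density \<mu> x" "f x"] by (auto simp: not_le)
        then show False using elim[rule_format, of q] x unfolding c by auto
      qed
    qed
  qed
qed

text \<open>Domination on small open sets extends to Lebesgue null sets by outer regularity and to all of
  \<open>U\<close> by the Lindelof property. So the measure has a Radon--Nikodym density on \<open>U\<close>, which is
  identified by differentiation.\<close>
theorem locally_dominated_measure_has_cube_density:
  fixes \<mu> :: "(real^'d) measure"
  assumes fin: "finite_measure \<mu>" and sets[simp]: "sets \<mu> = sets borel" and U: "open U"
    and dominated: "\<And>x. x \<in> U \<Longrightarrow> \<exists>r>0. \<exists>K\<ge>0. ball x r \<subseteq> U \<and>
      (\<forall>A. open A \<longrightarrow> A \<subseteq> ball x r \<longrightarrow> emeasure \<mu> A \<le> ennreal K * emeasure lborel A)"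
  shows "locally_bounded_on U (cube_density \<mu>)"
    and "\<And>A. A \<in> sets borel \<Longrightarrow> A \<subseteq> U \<Longrightarrow> emeasure \<mu> A = (\<integral>\<^sup>+x\<in>A. cube_density \<mu> x \<partial>lborel)"
proof -
  interpret finite_measure \<mu> by fact
  show "locally_bounded_on U (cube_density \<mu>)"
    unfolding locally_bounded_on_def
  proof
    fix x assume "x \<in> U"
    from dominated[OF this] obtain r K where r: "0 < r" "0 \<le> K"
      and K: "\<And>A. open A \<Longrightarrow> A \<subseteq> ball x r \<Longrightarrow> emeasure \<mu> A \<le> ennreal K * emeasure lborel A" by auto
    have "cube_density \<mu> y \<le> ennreal K" if y: "y \<in> ball x r" for y
    proof -
      have "\<forall>\<^sub>F e in at_right 0. sup_ball e y \<subseteq> ball x r"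
        using y by (intro eventually_sup_ball_subset) auto
      moreover have "\<forall>\<^sub>F e in at_right (0::real). 0 < e" by (simp add: eventually_at_right_less)
      ultimately have "\<forall>\<^sub>F e in at_right 0. ennreal (measure \<mu> (sup_ball e y) / (2 * e) ^ CARD('d)) \<le> ennreal K"
      proof eventually_elim
        case (elim e)
        have "emeasure \<mu> (sup_ball e y) \<le> ennreal K * emeasure lborel (sup_ball e y)"
          using elim by (intro K) auto
        also have "\<dots> = ennreal (K * (2 * e) ^ CARD('d))"
          using elim r by (simp add: emeasure_sup_ball ennreal_mult)
        finally have "measure \<mu> (sup_ball e y) \<le> K * (2 * e) ^ CARD('d)"
          using elim r by (simp add: emeasure_eq_measure)
        then show ?case using elim by (intro ennreal_leI) (simp add: pos_divide_le_eq)
      qed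
      then show ?thesis unfolding cube_density_def by (rule Limsup_bounded)
    qed
    then show "\<exists>V C. open V \<and> x \<in> V \<and> (\<forall>y\<in>V \<inter> U. cube_density \<mu> y \<le> ennreal C)"
      using r by (intro exI[of _ "ball x r"] exI[of _ K]) auto
  qed
next
  interpret finite_measure \<mu> by fact
  have U_borel[measurable]: "U \<in> sets borel" using U by simp
  define \<mu>U where "\<mu>U = density \<mu> (indicator U)"
  have sets\<mu>U: "sets \<mu>U = sets borel" by (simp add: \<mu>U_def)
  have \<mu>U_eq: "emeasure \<mu>U A = emeasure \<mu> (A \<inter> U)" if "A \<in> sets borel" for A
    using that by (simp add: \<mu>U_def emeasure_restricted Int_commute)
  have ball_null: "emeasure \<mu> (N \<inter> ball x r) = 0"
    if N: "N \<in> null_sets lborel" and K: "0 \<le> K" "\<And>A. open A \<Longrightarrow> A \<subseteq> ball x r \<Longrightarrow> emeasure \<mu> A \<le> ennreal K * emeasure lborel A"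
    for N x r K
  proof -
    have "emeasure \<mu> (N \<inter> ball x r) \<le> 0 + ennreal \<epsilon>" if \<epsilon>: "0 < \<epsilon>" for \<epsilon>
    proof -
      have Nb: "N \<in> sets borel" "emeasure lborel N = 0" using N by auto
      obtain G where G: "open G" "N \<subseteq> G" "emeasure lebesgue (G - N) < ennreal (\<epsilon> / (K + 1))"
      proof (rule sets_lebesgue_outer_open[of N "\<epsilon> / (K + 1)"])
        show "N \<in> sets lebesgue" using Nb by simp
        show "0 < \<epsilon> / (K + 1)" using \<epsilon> K(1) by simp
      qed
      have "emeasure lborel G = emeasure lborel (G - N)"
        using G(1) N by (simp add: emeasure_Diff_null_set)
      also have "\<dots> = emeasure lebesgue (G - N)"
        using G(1) Nb by simp
      also have "\<dots> \<le> ennreal (\<epsilon> / (K + 1))" using G(3) by (rule less_imp_le)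
      finally have G\<epsilon>: "emeasure lborel G \<le> ennreal (\<epsilon> / (K + 1))" .
      have "emeasure \<mu> (N \<inter> ball x r) \<le> emeasure \<mu> (G \<inter> ball x r)"
        using G by (intro emeasure_mono) auto
      also have "\<dots> \<le> ennreal K * emeasure lborel (G \<inter> ball x r)"
        using G by (intro K) auto
      also have "\<dots> \<le> ennreal K * emeasure lborel G"
        using G by (intro mult_left_mono emeasure_mono) auto
      also have "\<dots> \<le> ennreal K * ennreal (\<epsilon> / (K + 1))" by (intro mult_left_mono G\<epsilon>) auto
      also have "\<dots> = ennreal (K * (\<epsilon> / (K + 1)))" using K \<epsilon> by (subst ennreal_mult) auto
      also have "\<dots> \<le> ennreal \<epsilon>" using K \<epsilon> by (intro ennreal_leI) (simp add: field_simps)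
      finally show ?thesis by simp
    qed
    then have "emeasure \<mu> (N \<inter> ball x r) \<le> 0" by (rule ennreal_le_epsilon)
    then show ?thesis by simp
  qed
  have ac: "absolutely_continuous lborel \<mu>U"
    unfolding absolutely_continuous_def
  proof
    fix N :: "(real^'d) set" assume N: "N \<in> null_sets lborel"
    define \<F> where "\<F> = {ball x r | x r. \<exists>K\<ge>0. ball x r \<subseteq> U \<and>
      (\<forall>A. open A \<longrightarrow> A \<subseteq> ball x r \<longrightarrow> emeasure \<mu> A \<le> ennreal K * emeasure lborel A)}"
    have "\<And>S. S \<in> \<F> \<Longrightarrow> open S" by (auto simp: \<F>_def)
    then obtain \<G> where \<G>: "\<G> \<subseteq> \<F>" "countable \<G>" "\<Union>\<G> = \<Union>\<F>" by (rule Lindelof) auto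
    have "U \<subseteq> \<Union>\<F>"
    proof
      fix x assume "x \<in> U"
      from dominated[OF this] obtain r where "0 < r" "ball x r \<in> \<F>" unfolding \<F>_def by blast
      then show "x \<in> \<Union>\<F>" by (intro UnionI[of "ball x r"]) auto
    qed
    moreover have "(\<Union>B\<in>\<G>. N \<inter> B) \<in> null_sets \<mu>"
    proof (rule null_sets_UN'[OF \<G>(2)])
      fix B assume "B \<in> \<G>"
      then obtain x r K where B: "B = ball x r" and K: "0 \<le> K"
        "\<And>A. open A \<Longrightarrow> A \<subseteq> ball x r \<Longrightarrow> emeasure \<mu> A \<le> ennreal K * emeasure lborel A"
        using \<G>(1) unfolding \<F>_def by blast
      have "N \<in> sets borel" using N by auto
      then show "N \<inter> B \<in> null_sets \<mu>"
        using ball_null[OF N K] by (intro null_setsI) (auto simp: B)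
    qed
    moreover have "N \<inter> U \<subseteq> (\<Union>B\<in>\<G>. N \<inter> B)" using \<open>U \<subseteq> \<Union>\<F>\<close> \<G>(3) by blast
    ultimately have "emeasure \<mu> (N \<inter> U) \<le> 0"
      by (metis (no_types, lifting) emeasure_mono null_setsD1 null_setsD2)
    then show "N \<in> null_sets \<mu>U"
      using N \<mu>U_eq[of N] by (intro null_setsI) (auto simp: sets\<mu>U)
  qed
  define f where "f = RN_deriv lborel \<mu>U"
  have f[measurable]: "f \<in> borel_measurable borel"
    unfolding f_def using borel_measurable_RN_deriv[of lborel \<mu>U] by simp
  have dens: "density lborel f = \<mu>U"
    unfolding f_def using ac sets\<mu>U by (intro sigma_finite_measure.density_RN_deriv lborel.sigma_finite_measure_axioms) auto
  have density: "emeasure \<mu> A = (\<integral>\<^sup>+x\<in>A. f x \<partial>lborel)" if "A \<in> sets borel" "A \<subseteq> U" for A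
  proof -
    have "emeasure \<mu> A = emeasure (density lborel f) A"
      using \<mu>U_eq[OF that(1)] that(2) by (simp add: dens Int_absorb2)
    also have "\<dots> = (\<integral>\<^sup>+x\<in>A. f x \<partial>lborel)" using that by (subst emeasure_density) auto
    finally show ?thesis .
  qed
  fix A :: "(real^'d) set" assume A: "A \<in> sets borel" "A \<subseteq> U"
  have "(\<integral>\<^sup>+x\<in>A. f x \<partial>lborel) = (\<integral>\<^sup>+x\<in>A. cube_density \<mu> x \<partial>lborel)"
  proof (rule nn_integral_cong_AE)
    have "AE x in lborel. x \<in> U \<longrightarrow> cube_density \<mu> x = f x"
      by (rule cube_density_eq_density_AE[OF fin sets U_borel f]) (rule density)
    then show "AE x in lborel. f x * indicator A x = cube_density \<mu> x * indicator A x"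
      by eventually_elim (use A(2) in \<open>auto simp: indicator_def\<close>)
  qed
  then show "emeasure \<mu> A = (\<integral>\<^sup>+x\<in>A. cube_density \<mu> x \<partial>lborel)"
    using density[OF A] by simp
qed

section \<open>Constant diffusion and the law of the process\<close>

text \<open>The completeness of \<open>F 0\<close> carries over to the probability space.\<close>
lemma (in stochastic_basis) borel_measurable_AE_eq:
  fixes f g :: "'a \<Rightarrow> 'b::topological_space"
  assumes f: "f \<in> borel_measurable M" and eq: "AE \<omega> in M. g \<omega> = f \<omega>"
  shows "g \<in> borel_measurable M"
proof (rule measurableI)
  obtain N where N: "{\<omega> \<in> space M. g \<omega> \<noteq> f \<omega>} \<subseteq> N" "N \<in> null_sets M"
    using eq by (auto simp: eventually_ae_filter)
  fix B :: "'b set" assume B: "B \<in> sets borel"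
  have eq: "g -` B \<inter> space M = (f -` B \<inter> space M - N) \<union> (g -` B \<inter> space M \<inter> N)"
    using N by auto
  have "g -` B \<inter> space M \<inter> N \<in> sets M"
    using F_complete[OF N(2), of "g -` B \<inter> space M \<inter> N"] subalgebra_F[of 0]
    by (auto simp: subalgebra_def)
  moreover have "f -` B \<inter> space M - N \<in> sets M"
    using measurable_sets[OF f B] N(2) by (intro sets.Diff) auto
  ultimately show "g -` B \<inter> space M \<in> sets M" by (subst eq) (rule sets.Un)
qed auto

text \<open>The right inverse is \<open>S\<^sup>T (S S\<^sup>T)\<^sup>-\<^sup>1\<close>.\<close>
lemma positive_definite_imp_right_inverse:
  fixes S :: "real^'n^'d"
  assumes "positive_definite (S ** transpose S)"
  obtains R where "S ** R = mat 1"
proof -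
  let ?A = "S ** transpose S"
  have "x = 0" if "?A *v x = 0" for x
    using assms that unfolding positive_definite_def by (metis inner_zero_right less_irrefl)
  then obtain B where "B ** ?A = mat 1"
    using matrix_left_invertible_ker[of ?A] by blast
  then have "?A ** B = mat 1" by (simp add: matrix_left_right_inverse)
  then show ?thesis by (intro that[of "transpose S ** B"]) (simp add: matrix_mul_assoc)
qed

text \<open>The simple integrands \<open>S 1\<^bsub>(0, k]\<^esub>\<close> agree with the constant integrand on \<open>(0, T]\<close> as soon as
  \<open>k \<ge> T\<close>, so they approximate it trivially, and their integrals at time \<open>t\<close> are \<open>S W(t)\<close> for
  \<open>k \<ge> t\<close>. Uniqueness of limits in probability identifies the integral at each time, and continuity at
  all times at once.\<close>
lemma (in brownian_basis) Ito_integral_constant: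
  fixes \<sigma> :: "real \<Rightarrow> 'a \<Rightarrow> real^'n^'d"
  assumes I: "is_Ito_integral M F W \<sigma> I" and \<sigma>: "\<And>t \<omega>. 0 \<le> t \<Longrightarrow> \<omega> \<in> space M \<Longrightarrow> \<sigma> t \<omega> = S"
  shows "AE \<omega> in M. \<forall>t\<ge>0. I t \<omega> = S *v W t \<omega>"
proof -
  define H :: "nat \<Rightarrow> ('a, real^'n^'d) simple_integrand" where
    "H = (\<lambda>k. \<lparr>pieces = 1, gridpoint = (\<lambda>i. if i = 0 then 0 else real k), coefficient = (\<lambda>_ _. S)\<rparr>)"
  have approx: "simple_approximation M F H \<sigma>"
    unfolding simple_approximation_def
  proof (intro conjI allI impI)
    show "valid_simple_integrand M F (H k)" for k
      by (auto simp: valid_simple_integrand_def H_def)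
    fix T :: real assume T: "0 \<le> T"
    have zero: "(LINT s:{0..T}|lborel. (norm (simple_value (H k) s \<omega> - \<sigma> s \<omega>))\<^sup>2) = 0"
      if k: "T \<le> real k" and \<omega>: "\<omega> \<in> space M" for k \<omega>
    proof -
      have "AE s in lborel. indicator {0..T} s *\<^sub>R (norm (simple_value (H k) s \<omega> - \<sigma> s \<omega>))\<^sup>2 = 0"
        using AE_lborel_singleton[of "0::real"]
      proof eventually_elim
        case (elim s)
        then show ?case
          using k \<sigma>[of s \<omega>] \<omega> by (auto simp: simple_value_def H_def indicator_def)
      qed
      then show ?thesis unfolding set_lebesgue_integral_def by (rule integral_eq_zero_AE)
    qed
    show "tendsto_in_probability M (\<lambda>k \<omega>. LINT s:{0..T}|lborel. (norm (simple_value (H k) s \<omega> - \<sigma> s \<omega>))\<^sup>2) (\<lambda>\<omega>. 0)"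
      unfolding tendsto_in_probability_def
    proof (intro allI impI)
      fix e :: real assume e: "0 < e"
      obtain k0 :: nat where k0: "T \<le> real k0" using real_arch_simple by blast
      show "(\<lambda>k. prob {\<omega> \<in> space M. e < dist (LINT s:{0..T}|lborel. (norm (simple_value (H k) s \<omega> - \<sigma> s \<omega>))\<^sup>2) 0}) \<longlonglongrightarrow> 0"
      proof (rule tendsto_eventually)
        show "\<forall>\<^sub>F k in sequentially. prob {\<omega> \<in> space M. e < dist (LINT s:{0..T}|lborel. (norm (simple_value (H k) s \<omega> - \<sigma> s \<omega>))\<^sup>2) 0} = 0"
          using eventually_ge_at_top[of k0]
        proof eventually_elim
          case (elim k)
          then have "T \<le> real k" using k0 by simp
          then have "{\<omega> \<in> space M. e < dist (LINT s:{0..T}|lborel. (norm (simple_value (H k) s \<omega> - \<sigma> s \<omega>))\<^sup>2) 0} = {}"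
            using zero e by auto
          then show ?case by (simp only: measure_empty)
        qed
      qed
    qed
  qed
  have W0: "AE \<omega> in M. W 0 \<omega> = 0" and W_cont: "AE \<omega> in M. continuous_on {0..} (\<lambda>t. W t \<omega>)"
    using brownian by (auto simp: standard_brownian_motion_def)
  have I_cont: "AE \<omega> in M. continuous_on {0..} (\<lambda>t. I t \<omega>)"
    using I by (auto simp: is_Ito_integral_def)
  have at_t: "AE \<omega> in M. I t \<omega> = S *v W t \<omega>" if t: "0 \<le> t" for t
  proof -
    have [measurable]: "I t \<in> borel_measurable M" "W t \<in> borel_measurable M" "W 0 \<in> borel_measurable M"
      using I t measurable_F_M[of t "I t"] by (auto simp: is_Ito_integral_def adapted_def)
    let ?Z = "\<lambda>\<omega>. S *v (W t \<omega> - W 0 \<omega>)"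
    have Z: "simple_integral W (H k) t \<omega> = ?Z \<omega>" if "t \<le> real k" for k \<omega>
      using that t by (simp add: simple_integral_def H_def min_def)
    have lim: "tendsto_in_probability M (\<lambda>k. simple_integral W (H k) t) (I t)"
      using I approx t by (auto simp: is_Ito_integral_def)
    have null: "prob {\<omega> \<in> space M. e < dist (?Z \<omega>) (I t \<omega>)} = 0" if e: "0 < e" for e
    proof -
      obtain k0 :: nat where k0: "t \<le> real k0" using real_arch_simple by blast
      have "(\<lambda>k. prob {\<omega> \<in> space M. e < dist (simple_integral W (H k) t \<omega>) (I t \<omega>)}) \<longlonglongrightarrow> 0"
        using lim e by (auto simp: tendsto_in_probability_def)
      moreover have "\<forall>\<^sub>F k in sequentially. prob {\<omega> \<in> space M. e < dist (simple_integral W (H k) t \<omega>) (I t \<omega>)}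
          = prob {\<omega> \<in> space M. e < dist (?Z \<omega>) (I t \<omega>)}"
        using eventually_ge_at_top[of k0] by eventually_elim (use k0 in \<open>simp add: Z\<close>)
      ultimately have "(\<lambda>k::nat. prob {\<omega> \<in> space M. e < dist (?Z \<omega>) (I t \<omega>)}) \<longlonglongrightarrow> 0"
        using tendsto_cong by fastforce
      then show ?thesis by (simp add: LIMSEQ_const_iff)
    qed
    have "AE \<omega> in M. \<forall>n. dist (?Z \<omega>) (I t \<omega>) \<le> inverse (real (Suc n))"
      unfolding AE_all_countable
    proof
      fix n
      have "{\<omega> \<in> space M. inverse (real (Suc n)) < dist (?Z \<omega>) (I t \<omega>)} \<in> null_sets M"
        using null[of "inverse (real (Suc n))"] by (intro null_setsI) (simp_all add: emeasure_eq_measure)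
      then show "AE \<omega> in M. dist (?Z \<omega>) (I t \<omega>) \<le> inverse (real (Suc n))"
        by (rule AE_I') auto
    qed
    then show ?thesis
      using W0
    proof eventually_elim
      case (elim \<omega>)
      have "dist (?Z \<omega>) (I t \<omega>) \<le> 0"
      proof (rule field_le_epsilon)
        fix e :: real assume "0 < e"
        then obtain n where "inverse (real (Suc n)) < e" using reals_Archimedean by blast
        then show "dist (?Z \<omega>) (I t \<omega>) \<le> 0 + e" using elim(1)[rule_format, of n] by simp
      qed
      then show ?case using elim(2) by simp
    qed
  qed
  have "AE \<omega> in M. \<forall>q\<in>\<rat> \<inter> {0..}. I q \<omega> = S *v W q \<omega>"
    by (subst AE_ball_countable) (auto intro: at_t countable_rat countable_Int1)
  then show ?thesis
    using W_cont I_cont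
  proof eventually_elim
    case (elim \<omega>)
    show ?case
    proof (intro allI impI)
      fix t :: real assume t: "0 \<le> t"
      have "\<exists>q\<in>\<rat>. t < q \<and> q < t + inverse (real (Suc n))" for n
        by (rule Rats_dense_in_real) simp
      then obtain q where q: "\<And>n. q n \<in> \<rat>" "\<And>n. t < q n" "\<And>n. q n < t + inverse (real (Suc n))"
        by metis
      have qt: "q \<longlonglongrightarrow> t"
      proof (rule tendsto_sandwich[OF always_eventually always_eventually])
        show "\<forall>n. t \<le> q n" "\<forall>n. q n \<le> t + inverse (real (Suc n))" using q by (auto intro: less_imp_le)
        show "(\<lambda>n. t + inverse (real (Suc n))) \<longlonglongrightarrow> t"
          using tendsto_add[OF tendsto_const LIMSEQ_inverse_real_of_nat, of t] by simp
      qed auto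
      have q0: "q n \<in> {0..}" for n using q(2)[of n] t by simp
      have "(\<lambda>n. I (q n) \<omega>) \<longlonglongrightarrow> I t \<omega>"
        using qt q0 t by (intro continuous_on_tendsto_compose[OF elim(3)]) auto
      moreover have "(\<lambda>n. W (q n) \<omega>) \<longlonglongrightarrow> W t \<omega>"
        using qt q0 t by (intro continuous_on_tendsto_compose[OF elim(2)]) auto
      then have "(\<lambda>n. S *v W (q n) \<omega>) \<longlonglongrightarrow> S *v W t \<omega>"
        by (rule bounded_linear.tendsto[OF matrix_vector_mul_bounded_linear])
      moreover have "I (q n) \<omega> = S *v W (q n) \<omega>" for n using elim(1) q(1) q0 by blast
      ultimately show "I t \<omega> = S *v W t \<omega>"
        using LIMSEQ_unique by auto
    qed
  qed
qed

lemma limsup_density_eq_cube_density: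
  fixes Y :: "'a \<Rightarrow> real^'d"
  assumes [measurable]: "Y \<in> borel_measurable M"
  shows "limsup_density M Y = cube_density (distr M borel Y)"
proof
  fix x
  have pos: "\<forall>\<^sub>F e in at_right (0::real). 0 < e" by (simp add: eventually_at_right_less)
  have "\<forall>\<^sub>F e in at_right 0. ennreal (measure M {\<omega> \<in> space M. infnorm (Y \<omega> - x) < e} / measure lborel (sup_ball e (0 :: real^'d))) =
      ennreal (measure (distr M borel Y) (sup_ball e x) / (2 * e) ^ CARD('d))"
    using pos
  proof eventually_elim
    case (elim e)
    have "measure (distr M borel Y) (sup_ball e x) = measure M {\<omega> \<in> space M. infnorm (Y \<omega> - x) < e}"
    proof -
      have "Y -` sup_ball e x \<inter> space M = {\<omega> \<in> space M. infnorm (Y \<omega> - x) < e}"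
        by (auto simp: sup_ball_eq_infnorm)
      then show ?thesis by (simp add: measure_distr borel_open)
    qed
    moreover have "measure lborel (sup_ball e (0 :: real^'d)) = (2 * e) ^ CARD('d)"
      using elim by (simp add: measure_def emeasure_sup_ball)
    ultimately show ?case by simp
  qed
  then show "limsup_density M Y x = cube_density (distr M borel Y) x"
    unfolding limsup_density_def cube_density_def by (rule Limsup_eq)
qed

theorem theorem2p2:
  fixes M :: "'a measure" and F :: "real \<Rightarrow> 'a measure"
    and W :: "real \<Rightarrow> 'a \<Rightarrow> real^'n" and x0 :: "real^'d"
    and \<beta> :: "real \<Rightarrow> 'a \<Rightarrow> real^'d" and \<sigma> :: "real \<Rightarrow> 'a \<Rightarrow> real^'n^'d"
    and X :: "real \<Rightarrow> 'a \<Rightarrow> real^'d" and t :: real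
  assumes "stochastic_basis M F"
    and "Ito_process M F W x0 \<beta> \<sigma> X"
    and "constant_deterministic M \<sigma>"
    and "nondegenerate M \<sigma>"
    and "t > 0"
  shows "(\<forall>U. open U \<and> bounded_drift_in M \<beta> X U \<longrightarrow>
            locally_bounded_on U (limsup_density M (X t)) \<and>
            density_version_on M (X t) U (limsup_density M (X t))) \<and>
         (locally_bounded_drift M \<beta> X \<longrightarrow>
            (\<exists>f. distributed M lborel (X t) f \<and> locally_bounded_on UNIV f))"
proof -
  interpret stochastic_basis M F by fact
  obtain S where S: "\<And>t \<omega>. 0 \<le> t \<Longrightarrow> \<omega> \<in> space M \<Longrightarrow> \<sigma> t \<omega> = S"
    using assms(3) by (auto simp: constant_deterministic_def)
  obtain \<omega>0 where "\<omega>0 \<in> space M" using not_empty by blast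
  then have "positive_definite (S ** transpose S)"
    using assms(4) S[of 0 \<omega>0] unfolding nondegenerate_def by force
  then obtain R where SR: "S ** R = mat 1" by (rule positive_definite_imp_right_inverse)
  interpret brownian_basis M F W
    using assms(2) by unfold_locales (simp add: Ito_process_def)
  interpret drifted_brownian M F W S x0 \<beta>
    using assms(2) by unfold_locales (simp_all add: Ito_process_def)
  obtain I where I: "is_Ito_integral M F W \<sigma> I"
    and XI: "AE \<omega> in M. \<forall>t\<ge>0. X t \<omega> = x0 + (LINT s:{0..t}|lborel. \<beta> s \<omega>) + I t \<omega>"
    using assms(2) by (auto simp: Ito_process_def)
  have "AE \<omega> in M. \<forall>t\<ge>0. I t \<omega> = S *v W t \<omega>"
    by (rule Ito_integral_constant[OF I]) (rule S)
  with XI have X_drifted: "AE \<omega> in M. \<forall>t\<ge>0. X t \<omega> = drifted t \<omega>"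
    by eventually_elim (simp add: drifted_def)
  have drifted_t: "drifted t \<in> borel_measurable M" using assms(5) by simp
  have Xt[measurable]: "X t \<in> borel_measurable M"
    using X_drifted assms(5) by (intro borel_measurable_AE_eq[OF drifted_t]) (auto elim: eventually_mono)
  define \<mu> where "\<mu> = distr M borel (X t)"
  interpret \<mu>: prob_space \<mu> unfolding \<mu>_def by (rule prob_space_distr) (rule Xt)
  have sets\<mu>: "sets \<mu> = sets borel" by (simp add: \<mu>_def)
  have \<mu>: "emeasure \<mu> A = emeasure M {\<omega> \<in> space M. X t \<omega> \<in> A}" if "A \<in> sets borel" for A
    using that by (simp add: \<mu>_def emeasure_distr vimage_def Int_def conj_commute)
  have density_eq: "limsup_density M (X t) = cube_density \<mu>"
    unfolding \<mu>_def by (rule limsup_density_eq_cube_density) (rule Xt)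
  have density_measurable: "cube_density \<mu> \<in> borel_measurable borel"
    by (rule borel_measurable_cube_density[OF \<mu>.finite_measure_axioms sets\<mu>])
  \<comment> \<open>\<open>G\<close> will be the given set \<open>U\<close> in the first part and the unit ball around \<open>x\<close> in the second\<close>
  have dominated: "\<exists>r>0. \<exists>K\<ge>0. ball x r \<subseteq> G \<and>
      (\<forall>A. open A \<longrightarrow> A \<subseteq> ball x r \<longrightarrow> emeasure \<mu> A \<le> ennreal K * emeasure lborel A)"
    if G: "open G" "bounded_drift_in M \<beta> X G" and x: "x \<in> G" for G x
  proof -
    obtain \<rho> where \<rho>: "0 < \<rho>" "ball x \<rho> \<subseteq> G" using G(1) x by (meson open_contains_ball)
    obtain C where C: "0 < C" "AE \<omega> in M. \<forall>t\<ge>0. infnorm (\<beta> t \<omega>) * indicator G (X t \<omega>) \<le> C"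
      using G(2) by (auto simp: bounded_drift_in_def)
    define r where "r = \<rho> / 3"
    have r: "0 < r" "ball x (3 * r) \<subseteq> G" "ball x r \<subseteq> G"
      using \<rho> subset_ball[of r \<rho> x] by (auto simp: r_def)
    have drift: "AE \<omega> in M. \<forall>t\<ge>0. drifted t \<omega> \<in> ball x (3 * r) \<longrightarrow> norm (\<beta> t \<omega>) \<le> sqrt (real CARD('d)) * C"
      using C(2) X_drifted
    proof eventually_elim
      case (elim \<omega>)
      show ?case
      proof (intro allI impI)
        fix t :: real assume t: "0 \<le> t" and "drifted t \<omega> \<in> ball x (3 * r)"
        then have "X t \<omega> \<in> G" using elim(2) r(2) by auto
        then have "infnorm (\<beta> t \<omega>) \<le> C" using elim(1) t by (auto dest!: spec[of _ t])
        then have "sqrt (real CARD('d)) * infnorm (\<beta> t \<omega>) \<le> sqrt (real CARD('d)) * C"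
          by (intro mult_left_mono) auto
        moreover have "norm (\<beta> t \<omega>) \<le> sqrt (real CARD('d)) * infnorm (\<beta> t \<omega>)"
          using norm_le_infnorm[of "\<beta> t \<omega>"] by simp
        ultimately show "norm (\<beta> t \<omega>) \<le> sqrt (real CARD('d)) * C" by (rule order_trans[rotated])
      qed
    qed
    obtain K where K: "0 \<le> K" "\<And>A. open A \<Longrightarrow> A \<subseteq> ball x r \<Longrightarrow>
        emeasure M {\<omega> \<in> space M. drifted t \<omega> \<in> A} \<le> ennreal K * emeasure lborel A"
      using law_le_volume[OF SR r(1) _ assms(5) drift] C(1) by auto
    have "emeasure \<mu> A \<le> ennreal K * emeasure lborel A" if A: "open A" "A \<subseteq> ball x r" for A
    proof -
      have [measurable]: "A \<in> sets borel" using A(1) by simp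
      note drifted_t[measurable]
      have "emeasure \<mu> A = emeasure M {\<omega> \<in> space M. X t \<omega> \<in> A}" by (rule \<mu>) simp
      also have "\<dots> = emeasure M {\<omega> \<in> space M. drifted t \<omega> \<in> A}"
        using X_drifted assms(5) by (intro emeasure_eq_AE) (auto elim: eventually_mono)
      also have "\<dots> \<le> ennreal K * emeasure lborel A" by (rule K(2)[OF A])
      finally show ?thesis .
    qed
    then show ?thesis using r K(1) by blast
  qed
  have part1: "locally_bounded_on U (limsup_density M (X t)) \<and> density_version_on M (X t) U (limsup_density M (X t))"
    if U: "open U" "bounded_drift_in M \<beta> X U" for U
  proof -
    note th = locally_dominated_measure_has_cube_density[OF \<mu>.finite_measure_axioms sets\<mu> U(1) dominated[OF U]]
    have "cube_density \<mu> \<in> borel_measurable (restrict_space borel U)"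
      using density_measurable by (rule measurable_restrict_space1)
    then show ?thesis
      unfolding density_eq density_version_on_def using th \<mu> by auto
  qed
  have part2: "\<exists>f. distributed M lborel (X t) f \<and> locally_bounded_on UNIV f"
    if lb: "locally_bounded_drift M \<beta> X"
  proof (intro exI conjI)
    have dom: "\<exists>r>0. \<exists>K\<ge>0. ball x r \<subseteq> UNIV \<and>
        (\<forall>A. open A \<longrightarrow> A \<subseteq> ball x r \<longrightarrow> emeasure \<mu> A \<le> ennreal K * emeasure lborel A)" for x
    proof -
      have "bounded_drift_in M \<beta> X (ball x 1)" using lb by (simp add: locally_bounded_drift_def)
      from dominated[OF open_ball this, of x] show ?thesis by auto
    qed
    note th = locally_dominated_measure_has_cube_density[OF \<mu>.finite_measure_axioms sets\<mu> open_UNIV dom]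
    show "locally_bounded_on UNIV (cube_density \<mu>)" by (rule th(1))
    have "distr M lborel (X t) = density lborel (cube_density \<mu>)"
    proof (rule measure_eqI)
      fix A assume "A \<in> sets (distr M lborel (X t))"
      then have A: "A \<in> sets borel" by simp
      have "emeasure (distr M lborel (X t)) A = emeasure \<mu> A"
        using A by (simp add: \<mu>_def emeasure_distr)
      also have "\<dots> = (\<integral>\<^sup>+x\<in>A. cube_density \<mu> x \<partial>lborel)" by (rule th(2)[OF A]) simp
      also have "\<dots> = emeasure (density lborel (cube_density \<mu>)) A"
        using A density_measurable by (subst emeasure_density) auto
      finally show "emeasure (distr M lborel (X t)) A = emeasure (density lborel (cube_density \<mu>)) A" .
    qed simp
    then show "distributed M lborel (X t) (cube_density \<mu>)"
      using density_measurable by (simp add: distributed_def)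
  qed
  show ?thesis using part1 part2 by blast
qed

end
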